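(* Assume $u(t)=0$. Suppose there exists a constant $\delta^d>0$, independent of $N$, such that for every number of elements $N$, every $z\in\{p,q\}$ and every $i\in\{1,\dots,n\}$ the matrices $\Theta_{zi}$ and $O_{zi}$ associated with the parameter $\theta_i^{z}$ satisfy $$\Theta_{zi}-O_{zi}\ \ge\ \delta^d\,\Theta_{zi}$$ (in the sense of symmetric matrices, i.e. the difference is positive semidefinite). Set $$\epsilon_0=\frac{\eta_\Theta}{\ell\,\mu_{P_1}},\qquad \epsilon_1=\frac{2\eta_K}{\ell\,\mu_\Psi}.$$ Then for every $\epsilon\in(0,\min\{\epsilon_0,\epsilon_1\}]$ the discrete energy $\mathcal{H}_d(t)$ of the approximated system decays exponentially at least with the uniform rate (independent of $N$) $$\alpha^d=\frac{\delta^d\,\epsilon\,\epsilon_0}{\epsilon+\epsilon_0},$$ i.e. for each $N$ there is a constant $c_0\geq 1$ such that $\mathcal{H}_d(t)\le c_0\,e^{-\alpha^d t}\,\mathcal{H}_d(0)$ for all $t\ge 0$ and all solutions of the approximated system.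
   Context: Data: an interval $[x_l,x_r]$ with $\ell=x_r-x_l>0$; $n\ge1$; an invertible matrix $A\in\mathbb{R}^{n\times n}$; a diagonal matrix $K=\mathrm{diag}(\kappa_1,\dots,\kappa_n)>0$; strictly positive $C^1$ functions $\theta_i^{q},\theta_i^{p}$ on $[x_l,x_r]$, $i=1,\dots,n$. Put $\Theta_z(x)=\mathrm{diag}(\theta^z_1(x),\dots,\theta^z_n(x))$ for $z\in\{p,q\}$, $\Theta(x)=\mathrm{diag}(\Theta_q(x),\Theta_p(x))$, and $P_1=\begin{bmatrix}0&A\\ A^\top&0\end{bmatrix}$. Constants: $\eta_K=\min\mathrm{eig}(K)$, $\eta_\Theta=\min_{x\in[x_l,x_r]}\min\mathrm{eig}(\Theta(x))$, $\mu_{P_1}=\sqrt{\max\mathrm{eig}(P_1^{-2})}$, $\mu_\Psi=\max\mathrm{eig}(\Psi)$ with $\Psi=\begin{bmatrix}A^{-\top}K\\ I_n\end{bmatrix}^\top\Theta^{-1}(x_r)\begin{bmatrix}A^{-\top}K\\ I_n\end{bmatrix}$. Discretization: for $N\in\mathbb{N}$, $h=\ell/N$, $x_k=x_l+kh$, $\theta^z_{i,k}=\theta^z_i(x_k)$. Let $L\in\mathbb{R}^{N\times N}$ have ones on the first subdiagonal and zeros elsewhere, $M=\frac12(I_N+L^\top)$, $D=I_N-L$, $\boldsymbol{t}_r=[0,\dots,0,1]^\top\in\mathbb{R}^N$. With $\otimes$ the Kronecker product, $\bar M=I_n\otimes M$, $\bar D=I_n\otimes D$, $\bar A=A\otimes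 I_N$, $\bar B_2=K\otimes\boldsymbol{t}_r\boldsymbol{t}_r^\top$, $\bar B_1=\frac12\bar A^{-\top}\bar B_2$. For $z\in\{p,q\}$, $\Theta_{zi}=\mathrm{diag}(\theta^z_{i,1},\dots,\theta^z_{i,N})$ and $\bar\Theta_z=\mathrm{diag}(\Theta_{z1},\dots,\Theta_{zn})$. The matrix $O_{zi}\in\mathbb{R}^{N\times N}$ is the symmetric tridiagonal matrix with zero diagonal and entries $[O_{zi}]_{k,k+1}=[O_{zi}]_{k+1,k}=\frac{k}{2}(\theta^z_{i,k+1}-\theta^z_{i,k})$, $k=1,\dots,N-1$. The approximated system (with $u=0$) for $\boldsymbol{e}^q(t),\boldsymbol{e}^p(t)\in\mathbb{R}^{nN}$ is $$\begin{bmatrix}\bar\Theta_q^{-1}&0\\0&\bar\Theta_p^{-1}\end{bmatrix}\begin{bmatrix}\bar M&-\bar B_1\\0&\bar M^\top\end{bmatrix}\begin{bmatrix}\dot{\boldsymbol{e}}^q\\\dot{\boldsymbol{e}}^p\end{bmatrix}=\frac1h\begin{bmatrix}0&\bar A\bar D\\-\bar A^\top\bar D^\top&-\bar B_2\end{bmatrix}\begin{bmatrix}\boldsymbol{e}^q\\\boldsymbol{e}^p\end{bmatrix}.$$ Its discrete energy is $\mathcal{H}_d(t)=\frac12\left\langle S_d\begin{bmatrix}\boldsymbol{e}^q\\\boldsymbol{e}^p\end{bmatrix},Q_d\begin{bmatrix}\boldsymbol{e}^q\\\boldsymbol{e}^p\end{bmatrix}\right\rangle$ (Euclidean inner product), where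 $S_d=\begin{bmatrix}\bar\Theta_q^{-1}&0\\0&\bar\Theta_p^{-1}\end{bmatrix}\begin{bmatrix}\bar M&-\bar B_1\\0&\bar M^\top\end{bmatrix}$ and $Q_d=h\begin{bmatrix}\bar M&-\bar B_1\\0&\bar M^\top\end{bmatrix}$. *)

theory Defs
  imports
    "Jordan_Normal_Form.Gauss_Jordan_Elimination"
    "Jordan_Normal_Form.Spectral_Radius"
begin

section \<open>Matrices\<close>

text \<open>Matrices and vectors are indexed from 0; accordingly the \<open>k\<close>-th grid point
  (\<open>k = 1, \<dots>, N\<close>) belongs to row \<open>k - 1\<close>, and the parameter number \<open>i = 1, \<dots>, n\<close>
  is the function with index \<open>i - 1\<close>.\<close>

text \<open>Only meaningful for invertible matrices.\<close>

definition minv :: "'a :: field mat \<Rightarrow> 'a mat" where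
  "minv A = the (mat_inverse A)"

definition kron :: "'a :: semiring_0 mat \<Rightarrow> 'a mat \<Rightarrow> 'a mat" where
  "kron A B = mat (dim_row A * dim_row B) (dim_col A * dim_col B)
     (\<lambda>(i, j). A $$ (i div dim_row B, j div dim_col B) * B $$ (i mod dim_row B, j mod dim_col B))"

definition psd :: "real mat \<Rightarrow> bool" where
  "psd A \<longleftrightarrow> square_mat A \<and> transpose_mat A = A \<and>
     (\<forall>v \<in> carrier_vec (dim_row A). 0 \<le> v \<bullet> (A *\<^sub>v v))"

text \<open>Used only for real symmetric matrices, whose real spectrum is nonempty and is the full
  spectrum.\<close>

definition min_eig :: "real mat \<Rightarrow> real" where
  "min_eig A = Min (spectrum A)"

definition max_eig :: "real mat \<Rightarrow> real" where
  "max_eig A = Max (spectrum A)"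


section \<open>Continuous data\<close>

definition C1_on :: "real set \<Rightarrow> (real \<Rightarrow> real) \<Rightarrow> bool" where
  "C1_on S f \<longleftrightarrow> (\<exists>f'. (\<forall>x\<in>S. (f has_real_derivative f' x) (at x within S)) \<and> continuous_on S f')"

definition K_mat :: "nat \<Rightarrow> (nat \<Rightarrow> real) \<Rightarrow> real mat" where
  "K_mat n \<kappa> = mat_diag n \<kappa>"

definition P1_mat :: "nat \<Rightarrow> real mat \<Rightarrow> real mat" where
  "P1_mat n A = four_block_mat (0\<^sub>m n n) A (transpose_mat A) (0\<^sub>m n n)"

definition Theta_mat ::
  "nat \<Rightarrow> (nat \<Rightarrow> real \<Rightarrow> real) \<Rightarrow> (nat \<Rightarrow> real \<Rightarrow> real) \<Rightarrow> real \<Rightarrow> real mat" where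
  "Theta_mat n \<theta>q \<theta>p x =
     four_block_mat (mat_diag n (\<lambda>i. \<theta>q i x)) (0\<^sub>m n n) (0\<^sub>m n n) (mat_diag n (\<lambda>i. \<theta>p i x))"

definition Psi_mat ::
  "real \<Rightarrow> nat \<Rightarrow> real mat \<Rightarrow> (nat \<Rightarrow> real) \<Rightarrow> (nat \<Rightarrow> real \<Rightarrow> real) \<Rightarrow> (nat \<Rightarrow> real \<Rightarrow> real) \<Rightarrow> real mat" where
  "Psi_mat xr n A \<kappa> \<theta>q \<theta>p =
     (let C = (transpose_mat (minv A) * K_mat n \<kappa>) @\<^sub>r 1\<^sub>m n
      in transpose_mat C * minv (Theta_mat n \<theta>q \<theta>p xr) * C)"

definition eta_K :: "nat \<Rightarrow> (nat \<Rightarrow> real) \<Rightarrow> real" where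
  "eta_K n \<kappa> = min_eig (K_mat n \<kappa>)"

text \<open>The infimum is a minimum, since the functions \<open>\<theta>q i\<close>, \<open>\<theta>p i\<close> are continuous on the
  compact interval.\<close>

definition eta_Theta ::
  "real \<Rightarrow> real \<Rightarrow> nat \<Rightarrow> (nat \<Rightarrow> real \<Rightarrow> real) \<Rightarrow> (nat \<Rightarrow> real \<Rightarrow> real) \<Rightarrow> real" where
  "eta_Theta xl xr n \<theta>q \<theta>p = (INF x\<in>{xl..xr}. min_eig (Theta_mat n \<theta>q \<theta>p x))"

definition mu_P1 :: "nat \<Rightarrow> real mat \<Rightarrow> real" where
  "mu_P1 n A = sqrt (max_eig (minv (P1_mat n A) ^\<^sub>m 2))"

definition mu_Psi ::
  "real \<Rightarrow> nat \<Rightarrow> real mat \<Rightarrow> (nat \<Rightarrow> real) \<Rightarrow> (nat \<Rightarrow> real \<Rightarrow> real) \<Rightarrow> (nat \<Rightarrow> real \<Rightarrow> real) \<Rightarrow> real" where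
  "mu_Psi xr n A \<kappa> \<theta>q \<theta>p = max_eig (Psi_mat xr n A \<kappa> \<theta>q \<theta>p)"

definition eps0 ::
  "real \<Rightarrow> real \<Rightarrow> nat \<Rightarrow> real mat \<Rightarrow> (nat \<Rightarrow> real \<Rightarrow> real) \<Rightarrow> (nat \<Rightarrow> real \<Rightarrow> real) \<Rightarrow> real" where
  "eps0 xl xr n A \<theta>q \<theta>p = eta_Theta xl xr n \<theta>q \<theta>p / ((xr - xl) * mu_P1 n A)"

definition eps1 ::
  "real \<Rightarrow> real \<Rightarrow> nat \<Rightarrow> real mat \<Rightarrow> (nat \<Rightarrow> real) \<Rightarrow> (nat \<Rightarrow> real \<Rightarrow> real) \<Rightarrow> (nat \<Rightarrow> real \<Rightarrow> real) \<Rightarrow> real" where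
  "eps1 xl xr n A \<kappa> \<theta>q \<theta>p = 2 * eta_K n \<kappa> / ((xr - xl) * mu_Psi xr n A \<kappa> \<theta>q \<theta>p)"


section \<open>Discretization\<close>

definition step :: "real \<Rightarrow> real \<Rightarrow> nat \<Rightarrow> real" where
  "step xl xr N = (xr - xl) / real N"

definition node :: "real \<Rightarrow> real \<Rightarrow> nat \<Rightarrow> nat \<Rightarrow> real" where
  "node xl xr N k = xl + real k * step xl xr N"

definition L_mat :: "nat \<Rightarrow> real mat" where
  "L_mat N = mat N N (\<lambda>(i, j). if i = j + 1 then 1 else 0)"

definition M_mat :: "nat \<Rightarrow> real mat" where
  "M_mat N = (1 / 2) \<cdot>\<^sub>m (1\<^sub>m N + transpose_mat (L_mat N))"

definition D_mat :: "nat \<Rightarrow> real mat" where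
  "D_mat N = 1\<^sub>m N - L_mat N"

definition tr_mat :: "nat \<Rightarrow> real mat" where
  "tr_mat N = mat N 1 (\<lambda>(i, j). if i + 1 = N then 1 else 0)"

definition M_bar :: "nat \<Rightarrow> nat \<Rightarrow> real mat" where
  "M_bar n N = kron (1\<^sub>m n) (M_mat N)"

definition D_bar :: "nat \<Rightarrow> nat \<Rightarrow> real mat" where
  "D_bar n N = kron (1\<^sub>m n) (D_mat N)"

definition A_bar :: "real mat \<Rightarrow> nat \<Rightarrow> real mat" where
  "A_bar A N = kron A (1\<^sub>m N)"

definition B2_bar :: "nat \<Rightarrow> (nat \<Rightarrow> real) \<Rightarrow> nat \<Rightarrow> real mat" where
  "B2_bar n \<kappa> N = kron (K_mat n \<kappa>) (tr_mat N * transpose_mat (tr_mat N))"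

definition B1_bar :: "nat \<Rightarrow> real mat \<Rightarrow> (nat \<Rightarrow> real) \<Rightarrow> nat \<Rightarrow> real mat" where
  "B1_bar n A \<kappa> N = (1 / 2) \<cdot>\<^sub>m (transpose_mat (minv (A_bar A N)) * B2_bar n \<kappa> N)"

text \<open>\<open>Theta_disc\<close> and \<open>O_disc\<close> are the matrices attached to a single parameter function.\<close>

definition Theta_disc :: "real \<Rightarrow> real \<Rightarrow> nat \<Rightarrow> (real \<Rightarrow> real) \<Rightarrow> real mat" where
  "Theta_disc xl xr N \<theta> = mat_diag N (\<lambda>r. \<theta> (node xl xr N (r + 1)))"

text \<open>For \<open>k = 1, \<dots>, N - 1\<close> the off-diagonal entry
  \<open>k / 2 * (\<theta> x\<^bsub>k+1\<^esub> - \<theta> x\<^bsub>k\<^esub>)\<close> sits at the 0-based positions \<open>(k - 1, k)\<close> and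
  \<open>(k, k - 1)\<close>; so \<open>k\<close> is the larger of the two indices.\<close>

definition O_disc :: "real \<Rightarrow> real \<Rightarrow> nat \<Rightarrow> (real \<Rightarrow> real) \<Rightarrow> real mat" where
  "O_disc xl xr N \<theta> =
     (let w = (\<lambda>k. real k / 2 * (\<theta> (node xl xr N (k + 1)) - \<theta> (node xl xr N k)))
      in mat N N (\<lambda>(r, c). if c = r + 1 then w c else if r = c + 1 then w r else 0))"

definition Theta_bar :: "real \<Rightarrow> real \<Rightarrow> nat \<Rightarrow> nat \<Rightarrow> (nat \<Rightarrow> real \<Rightarrow> real) \<Rightarrow> real mat" where
  "Theta_bar xl xr n N \<theta> = diag_block_mat (map (\<lambda>i. Theta_disc xl xr N (\<theta> i)) [0..<n])"

definition E_mat :: "nat \<Rightarrow> real mat \<Rightarrow> (nat \<Rightarrow> real) \<Rightarrow> nat \<Rightarrow> real mat" where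
  "E_mat n A \<kappa> N =
     four_block_mat (M_bar n N) (- B1_bar n A \<kappa> N) (0\<^sub>m (n * N) (n * N)) (transpose_mat (M_bar n N))"

definition J_mat :: "nat \<Rightarrow> real mat \<Rightarrow> (nat \<Rightarrow> real) \<Rightarrow> nat \<Rightarrow> real mat" where
  "J_mat n A \<kappa> N =
     four_block_mat (0\<^sub>m (n * N) (n * N)) (A_bar A N * D_bar n N)
       (- (transpose_mat (A_bar A N) * transpose_mat (D_bar n N))) (- B2_bar n \<kappa> N)"

definition Sd_mat ::
  "real \<Rightarrow> real \<Rightarrow> nat \<Rightarrow> real mat \<Rightarrow> (nat \<Rightarrow> real) \<Rightarrow> (nat \<Rightarrow> real \<Rightarrow> real) \<Rightarrow> (nat \<Rightarrow> real \<Rightarrow> real)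
    \<Rightarrow> nat \<Rightarrow> real mat" where
  "Sd_mat xl xr n A \<kappa> \<theta>q \<theta>p N =
     four_block_mat (minv (Theta_bar xl xr n N \<theta>q)) (0\<^sub>m (n * N) (n * N))
       (0\<^sub>m (n * N) (n * N)) (minv (Theta_bar xl xr n N \<theta>p))
     * E_mat n A \<kappa> N"

definition Qd_mat :: "real \<Rightarrow> real \<Rightarrow> nat \<Rightarrow> real mat \<Rightarrow> (nat \<Rightarrow> real) \<Rightarrow> nat \<Rightarrow> real mat" where
  "Qd_mat xl xr n A \<kappa> N = step xl xr N \<cdot>\<^sub>m E_mat n A \<kappa> N"

definition has_vec_derivative_within ::
  "(real \<Rightarrow> real vec) \<Rightarrow> real vec \<Rightarrow> real \<Rightarrow> real set \<Rightarrow> bool" where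
  "has_vec_derivative_within f d t S \<longleftrightarrow>
     (\<forall>i < dim_vec d. ((\<lambda>s. f s $ i) has_real_derivative d $ i) (at t within S))"

definition approx_solution ::
  "real \<Rightarrow> real \<Rightarrow> nat \<Rightarrow> real mat \<Rightarrow> (nat \<Rightarrow> real) \<Rightarrow> (nat \<Rightarrow> real \<Rightarrow> real) \<Rightarrow> (nat \<Rightarrow> real \<Rightarrow> real)
    \<Rightarrow> nat \<Rightarrow> (real \<Rightarrow> real vec) \<Rightarrow> (real \<Rightarrow> real vec) \<Rightarrow> bool" where
  "approx_solution xl xr n A \<kappa> \<theta>q \<theta>p N vq vp \<longleftrightarrow>
     (\<forall>t\<ge>0. vq t \<in> carrier_vec (n * N) \<and> vp t \<in> carrier_vec (n * N) \<and>
       (\<exists>dq \<in> carrier_vec (n * N). \<exists>dp \<in> carrier_vec (n * N).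
          has_vec_derivative_within vq dq t {0..} \<and>
          has_vec_derivative_within vp dp t {0..} \<and>
          Sd_mat xl xr n A \<kappa> \<theta>q \<theta>p N *\<^sub>v (dq @\<^sub>v dp) =
            (1 / step xl xr N) \<cdot>\<^sub>v (J_mat n A \<kappa> N *\<^sub>v (vq t @\<^sub>v vp t))))"

definition disc_energy ::
  "real \<Rightarrow> real \<Rightarrow> nat \<Rightarrow> real mat \<Rightarrow> (nat \<Rightarrow> real) \<Rightarrow> (nat \<Rightarrow> real \<Rightarrow> real) \<Rightarrow> (nat \<Rightarrow> real \<Rightarrow> real)
    \<Rightarrow> nat \<Rightarrow> real vec \<Rightarrow> real vec \<Rightarrow> real" where
  "disc_energy xl xr n A \<kappa> \<theta>q \<theta>p N vq vp =
     1 / 2 * ((Sd_mat xl xr n A \<kappa> \<theta>q \<theta>p N *\<^sub>v (vq @\<^sub>v vp)) \<bullet> (Qd_mat xl xr n A \<kappa> N *\<^sub>v (vq @\<^sub>v vp)))"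

end

theory Submission
  imports Defs
begin

text \<open>On every element let \<open>f\<^sup>q\<close>, \<open>f\<^sup>p\<close> be the averages of the nodal values of \<open>e\<^sup>q\<close>, \<open>e\<^sup>p\<close> and
  \<open>q = \<Theta>\<^sub>q\<^sup>-\<^sup>1 f\<^sup>q\<close>, \<open>p = \<Theta>\<^sub>p\<^sup>-\<^sup>1 f\<^sup>p\<close>. The system says that the derivatives of \<open>q\<close> and \<open>p\<close> are the
  difference quotients \<open>A \<Delta>e\<^sup>p / h\<close> and \<open>A\<^sup>T \<Delta>e\<^sup>q / h\<close>. The energy is dissipated only at the right end,
  at the rate \<open>\<langle>K e\<^sup>p, e\<^sup>p\<rangle>\<close>. Perturb it by \<open>\<epsilon>\<close> times a weighted coupling of \<open>q\<close> and \<open>A\<^sup>-\<^sup>T p\<close>, where the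
  weight is a symmetric tridiagonal discretization of multiplication by \<open>x - x\<^sub>l\<close>. Summation by parts
  turns the derivative of the coupling into a boundary term, which is absorbed by the dissipation if
  \<open>\<epsilon> \<le> \<epsilon>\<^sub>1\<close>, minus half of the quadratic form of \<open>\<Theta> - O\<close>, which dominates \<open>\<delta>\<close> times the energy.\<close>

text \<open>The summation by parts is exact, so no truncation error of the mesh enters and the rate
  can be uniform in N. What distinguishes it from the case of constant parameters is the jump of
  \<open>\<theta>\<close> between neighbouring elements; these jumps, weighted by the position, form
  precisely the quadratic form of \<open>O\<close>, hence the shape of the hypothesis.

  \<open>1 / \<epsilon>\<^sub>0\<close> bounds the ratio of coupling to energy, since the weight is
  at most the length of the interval. With H the energy, the perturbed functional F satisfies F <=
  (1 + \<epsilon> / \<open>\<epsilon>\<^sub>0\<close>) H and F' <= - \<delta> \<epsilon> H; the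
  quotient of these constants is the claimed rate. The delicate point is the closed end \<epsilon> =
  \<open>\<epsilon>\<^sub>0\<close>, where the matching lower bound (1 - \<epsilon> /
  \<open>\<epsilon>\<^sub>0\<close>) H for F is void. It is rescued by the midpoints of the
  elements: in units of h, the discrete weight has row sums k + 1/2, and the largest stays half a
  step below N. At that end the constant in front of the exponential becomes 4 N - 1.\<close>

section \<open>The discrete multiplier\<close>

text \<open>The kernel of the multiplier functional: a discrete version of the weight \<open>x - x\<^sub>l\<close>. The
  last weight \<open>(m + 1) / 2\<close> is the one for which the boundary term in \<open>wform_difference_le\<close>
  contains only the value at the right end point and a term of good sign.\<close>

definition wform :: "nat \<Rightarrow> (nat \<Rightarrow> real) \<Rightarrow> (nat \<Rightarrow> real) \<Rightarrow> real" where
  "wform m p d = (\<Sum>k<m. real (k + 1) / 4 * ((p k + p (k + 1)) * (d k + d (k + 1))))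
     + real (m + 1) / 2 * (p m * d m)"

lemma wform_commute: "wform m p d = wform m d p"
  by (simp add: wform_def mult.commute)

lemma wform_add_left: "wform m (\<lambda>k. p k + p' k) d = wform m p d + wform m p' d"
  by (simp add: wform_def sum.distrib distrib_left distrib_right)

lemma wform_scale_left: "wform m (\<lambda>k. c * p k) d = c * wform m p d"
  by (simp add: wform_def sum_distrib_left algebra_simps)

lemma wform_sum_left:
  "wform m (\<lambda>k. \<Sum>j\<in>J. c j * p j k) d = (\<Sum>j\<in>J. c j * wform m (p j) d)"
proof (induction J rule: infinite_finite_induct)
  case (insert j J)
  then show ?case by (simp add: wform_add_left wform_scale_left)
qed (simp_all add: wform_def)

lemma wform_cong:
  assumes "\<And>k. k \<le> m \<Longrightarrow> p k = p' k" "\<And>k. k \<le> m \<Longrightarrow> d k = d' k"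
  shows "wform m p d = wform m p' d'"
  using assms by (simp add: wform_def)

lemma has_real_derivative_wform:
  assumes "\<And>k. k \<le> m \<Longrightarrow> ((\<lambda>s. p s k) has_real_derivative p' k) (at t within S)"
    and "\<And>k. k \<le> m \<Longrightarrow> ((\<lambda>s. d s k) has_real_derivative d' k) (at t within S)"
  shows "((\<lambda>s. wform m (p s) (d s)) has_real_derivative (wform m p' (d t) + wform m (p t) d'))
           (at t within S)"
proof -
  have "((\<lambda>s. wform m (p s) (d s)) has_real_derivative
      (\<Sum>k<m. real (k + 1) / 4 * ((p' k + p' (k + 1)) * (d t k + d t (k + 1))
          + (d' k + d' (k + 1)) * (p t k + p t (k + 1))))
        + real (m + 1) / 2 * (p' m * d t m + d' m * p t m)) (at t within S)"
    unfolding wform_def by (intro DERIV_add DERIV_sum DERIV_cmult DERIV_mult assms) auto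
  then show ?thesis
    by (simp add: wform_def sum.distrib distrib_left mult.commute add_ac)
qed

text \<open>Abel summation, the discrete form of integrating x g' by parts: the linear weight is
  traded for a boundary value and the unweighted sum, which becomes the energy.\<close>

lemma sum_weighted_telescope:
  fixes g :: "nat \<Rightarrow> real"
  shows "(\<Sum>k<m. real (k + 1) * (g (k + 1) - g k)) = real (m + 1) * g m - (\<Sum>k\<le>m. g k)"
  by (induction m) (auto simp: algebra_simps)

text \<open>Since \<open>\<theta> k * p k\<close> is an average of \<open>x\<close>, two adjacent
  increments of \<open>x\<close> add up to twice the increment of \<open>\<theta> k * p k\<close>.
  Multiplied by \<open>p k + p (k + 1)\<close>, this is the increment of
  \<open>\<theta> k * (p k)\<^sup>2\<close> plus the defect
  \<open>(\<theta> (k + 1) - \<theta> k) * (p k * p (k + 1))\<close>. Up to here everything is an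
  identity; only the boundary term is estimated.\<close>

lemma wform_difference_le:
  fixes x \<theta> p :: "nat \<Rightarrow> real"
  assumes \<theta>: "\<And>k. k \<le> m \<Longrightarrow> \<theta> k > 0"
    and p: "\<And>k. k \<le> m \<Longrightarrow> p k = (x k + x (k + 1)) / 2 / \<theta> k"
  shows "wform m p (\<lambda>k. x (k + 1) - x k) \<le> real (m + 1) / 2 * ((x (m + 1))\<^sup>2 / \<theta> m)
     - 1 / 2 * ((\<Sum>k\<le>m. \<theta> k * (p k)\<^sup>2)
         - (\<Sum>k<m. real (k + 1) * (\<theta> (k + 1) - \<theta> k) * (p k * p (k + 1))))"
proof -
  let ?d = "\<lambda>k. x (k + 1) - x k" and ?g = "\<lambda>k. \<theta> k * (p k)\<^sup>2"
  have mid: "(x k + x (k + 1)) = 2 * \<theta> k * p k" if "k \<le> m" for k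
    using p[OF that] \<theta>[OF that] by simp
  have "(\<Sum>k<m. real (k + 1) / 4 * ((p k + p (k + 1)) * (?d k + ?d (k + 1))))
      = (\<Sum>k<m. 1 / 2 * (real (k + 1) * (?g (k + 1) - ?g k))
           + 1 / 2 * (real (k + 1) * (\<theta> (k + 1) - \<theta> k) * (p k * p (k + 1))))"
  proof (rule sum.cong[OF refl])
    fix k assume "k \<in> {..<m}"
    then have k: "k \<le> m" "k + 1 \<le> m" by auto
    have d: "?d k + ?d (k + 1) = 2 * (\<theta> (k + 1) * p (k + 1) - \<theta> k * p k)"
      using mid[OF k(1)] mid[OF k(2)] by (simp add: algebra_simps)
    show "real (k + 1) / 4 * ((p k + p (k + 1)) * (?d k + ?d (k + 1)))
      = 1 / 2 * (real (k + 1) * (?g (k + 1) - ?g k))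
           + 1 / 2 * (real (k + 1) * (\<theta> (k + 1) - \<theta> k) * (p k * p (k + 1)))"
      unfolding d by (simp add: field_simps power2_eq_square)
  qed
  also have "\<dots> = 1 / 2 * (real (m + 1) * ?g m - (\<Sum>k\<le>m. ?g k))
      + 1 / 2 * (\<Sum>k<m. real (k + 1) * (\<theta> (k + 1) - \<theta> k) * (p k * p (k + 1)))"
    unfolding sum.distrib sum_distrib_left[symmetric] sum_weighted_telescope[of ?g m] ..
  finally have "wform m p ?d = real (m + 1) / 2 * (?g m + p m * ?d m)
      - 1 / 2 * ((\<Sum>k\<le>m. ?g k) - (\<Sum>k<m. real (k + 1) * (\<theta> (k + 1) - \<theta> k) * (p k * p (k + 1))))"
    unfolding wform_def by (simp add: algebra_simps)
  \<comment> \<open>Completing the square: with f the average and d the increment on the last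
    element, f^2 + f d = (f + d/2)^2 - (d/2)^2, and f + d/2 is the value of \<open>x\<close> at the
    right end.\<close>
  moreover have "?g m + p m * ?d m \<le> (x (m + 1))\<^sup>2 / \<theta> m"
  proof -
    have "?g m + p m * ?d m = ((x (m + 1))\<^sup>2 - (?d m / 2)\<^sup>2) / \<theta> m"
      using \<theta>[of m] unfolding p[OF order_refl] by (simp add: field_simps power2_eq_square)
    also have "\<dots> \<le> (x (m + 1))\<^sup>2 / \<theta> m"
      using \<theta>[of m] by (intro divide_right_mono) auto
    finally show ?thesis .
  qed
  ultimately show ?thesis
    by (smt (verit) mult_left_mono divide_nonneg_nonneg of_nat_0_le_iff)
qed

text \<open>Gronwall with the integrating factor exp(\<alpha> t). At 0 only a one-sided derivative
  is available, so monotonicity is derived from the derivative in the open interval and continuity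
  on the closed one.\<close>

lemma exp_decay:
  fixes g :: "real \<Rightarrow> real"
  assumes g: "\<And>t. t \<ge> 0 \<Longrightarrow> (g has_real_derivative g' t) (at t within {0..})"
    and le: "\<And>t. t \<ge> 0 \<Longrightarrow> g' t \<le> - \<alpha> * g t" and "t \<ge> 0"
  shows "g t \<le> exp (- \<alpha> * t) * g 0"
proof -
  let ?f = "\<lambda>t. exp (\<alpha> * t) * g t"
  have D: "(?f has_real_derivative (exp (\<alpha> * t) * (g' t + \<alpha> * g t))) (at t within {0..})" if "t \<ge> 0" for t
    by (auto intro!: derivative_eq_intros g that simp: algebra_simps)
  have "?f 0 \<ge> ?f t"
  proof (cases "t = 0")
    case False
    show ?thesis
    proof (rule DERIV_nonpos_imp_decreasing_open[OF \<open>t \<ge> 0\<close>])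
      fix x assume x: "0 < x" "x < t"
      have "(at x within {0..}) = at x within UNIV"
        using x by (intro at_within_nhd[of x "{0<..}"]) auto
      then show "\<exists>y. (?f has_real_derivative y) (at x) \<and> y \<le> 0"
        using D[of x] le[of x] x by (auto intro!: exI mult_nonneg_nonpos)
    next
      show "continuous_on {0..t} ?f"
        by (rule continuous_on_subset[of "{0..}"]) (auto intro!: DERIV_continuous_on D)
    qed
  qed simp
  then show ?thesis by (simp add: exp_minus field_simps)
qed

lemma sum_swap3:
  "(\<Sum>i\<in>I. \<Sum>j\<in>J. \<Sum>k\<in>K. f i j k) = (\<Sum>k\<in>K. \<Sum>i\<in>I. \<Sum>j\<in>J. f i j k)"
proof -
  have "(\<Sum>i\<in>I. \<Sum>j\<in>J. \<Sum>k\<in>K. f i j k) = (\<Sum>i\<in>I. \<Sum>k\<in>K. \<Sum>j\<in>J. f i j k)"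
    by (intro sum.cong refl sum.swap)
  also have "\<dots> = (\<Sum>k\<in>K. \<Sum>i\<in>I. \<Sum>j\<in>J. f i j k)"
    by (rule sum.swap)
  finally show ?thesis .
qed

section \<open>The system in scalar form and the decay of its energy\<close>

text \<open>The \<open>m + 1\<close> elements are indexed from 0; \<open>G\<close> is the inverse of \<open>A\<close>, and \<open>\<mu>\<close>, \<open>\<nu>\<close> play the
  roles of the constants \<open>\<mu>\<close> of \<open>P\<^sub>1\<close> and \<open>\<Psi>\<close>.\<close>

locale semidiscrete_system =
  fixes n m :: nat and A G :: "nat \<Rightarrow> nat \<Rightarrow> real" and \<kappa> :: "nat \<Rightarrow> real"
    and \<theta>q \<theta>p :: "nat \<Rightarrow> nat \<Rightarrow> real" and h \<delta> \<mu> \<nu> \<eta> \<eta>\<^sub>K :: real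
  assumes h: "h > 0"
    and \<delta>: "\<delta> > 0"
    and inverse: "\<And>j l. j < n \<Longrightarrow> l < n \<Longrightarrow> (\<Sum>i<n. G j i * A i l) = (if j = l then 1 else 0)"
      "\<And>i l. i < n \<Longrightarrow> l < n \<Longrightarrow> (\<Sum>j<n. G j i * A l j) = (if i = l then 1 else 0)"
    and \<eta>: "\<eta> > 0" "\<And>i k. i < n \<Longrightarrow> k \<le> m \<Longrightarrow> \<eta> \<le> \<theta>q i k" "\<And>i k. i < n \<Longrightarrow> k \<le> m \<Longrightarrow> \<eta> \<le> \<theta>p i k"
    and \<eta>\<^sub>K: "\<And>i. i < n \<Longrightarrow> \<eta>\<^sub>K \<le> \<kappa> i"
    and \<mu>: "\<mu> > 0" "\<And>x y. 2 * \<bar>\<Sum>i<n. \<Sum>j<n. G j i * (x i * y j)\<bar> \<le> \<mu> * (\<Sum>i<n. (x i)\<^sup>2 + (y i)\<^sup>2)"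
    and \<nu>: "\<And>y. (\<Sum>i<n. (\<Sum>l<n. G l i * (\<kappa> l * y l))\<^sup>2 / \<theta>q i m + (y i)\<^sup>2 / \<theta>p i m) \<le> \<nu> * (\<Sum>i<n. (y i)\<^sup>2)"
    and coercive: "\<And>\<theta> i p. \<theta> \<in> {\<theta>q, \<theta>p} \<Longrightarrow> i < n \<Longrightarrow> \<delta> * (\<Sum>k\<le>m. \<theta> i k * (p k)\<^sup>2)
         \<le> (\<Sum>k\<le>m. \<theta> i k * (p k)\<^sup>2) - (\<Sum>k<m. real (k + 1) * (\<theta> i (k + 1) - \<theta> i k) * (p k * p (k + 1)))"
begin

definition energy :: "(nat \<Rightarrow> nat \<Rightarrow> real) \<Rightarrow> (nat \<Rightarrow> nat \<Rightarrow> real) \<Rightarrow> real" where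
  "energy q p = h / 2 * (\<Sum>i<n. \<Sum>k\<le>m. \<theta>q i k * (q i k)\<^sup>2 + \<theta>p i k * (p i k)\<^sup>2)"

text \<open>The discrete form of one half of the integral of (x - x_l) times the quadratic form of
  the inverse of P_1 at (q, p). One factor \<open>h\<close> is the quadrature weight, the other
  belongs to x - x_l, which \<open>wform\<close> measures in units of \<open>h\<close>.\<close>

definition cross_term :: "(nat \<Rightarrow> nat \<Rightarrow> real) \<Rightarrow> (nat \<Rightarrow> nat \<Rightarrow> real) \<Rightarrow> real" where
  "cross_term q p = h\<^sup>2 * (\<Sum>i<n. \<Sum>j<n. G j i * wform m (q i) (p j))"

lemma \<theta>_pos: "i < n \<Longrightarrow> k \<le> m \<Longrightarrow> \<theta>q i k > 0" "i < n \<Longrightarrow> k \<le> m \<Longrightarrow> \<theta>p i k > 0"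
  using \<eta>(1) \<eta>(2,3)[of i k] by auto

lemma energy_nonneg: "energy q p \<ge> 0"
  unfolding energy_def using h
  by (intro mult_nonneg_nonneg sum_nonneg add_nonneg_nonneg) (auto intro: less_imp_le \<theta>_pos)

lemma energy_ge: "h / 2 * \<eta> * (\<Sum>k\<le>m. \<Sum>i<n. (q i k)\<^sup>2 + (p i k)\<^sup>2) \<le> energy q p"
proof -
  have "\<eta> * (\<Sum>i<n. \<Sum>k\<le>m. (q i k)\<^sup>2 + (p i k)\<^sup>2)
      \<le> (\<Sum>i<n. \<Sum>k\<le>m. \<theta>q i k * (q i k)\<^sup>2 + \<theta>p i k * (p i k)\<^sup>2)"
    unfolding sum_distrib_left distrib_left
    by (intro sum_mono add_mono mult_right_mono \<eta>) auto
  then have "h / 2 * (\<eta> * (\<Sum>i<n. \<Sum>k\<le>m. (q i k)\<^sup>2 + (p i k)\<^sup>2)) \<le> energy q p"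
    unfolding energy_def using h by (intro mult_left_mono) auto
  then show ?thesis unfolding mult.assoc by (subst sum.swap)
qed

text \<open>For each weight of \<open>wform\<close>, \<mu> bounds the coupling of the vectors of all
  n components. What remains are the row sums of the kernel of \<open>wform\<close>, namely k + 1/2,
  so the constant is m + 1/2 and not the number m + 1 of elements.\<close>

lemma cross_term_bound:
  "\<bar>cross_term q p\<bar> \<le> h\<^sup>2 * (\<mu> / 2 * (real m + 1 / 2) * (\<Sum>k\<le>m. \<Sum>i<n. (q i k)\<^sup>2 + (p i k)\<^sup>2))"
proof -
  define g where "g k = (\<Sum>i<n. (q i k)\<^sup>2 + (p i k)\<^sup>2)" for k
  let ?C = "\<Sum>i<n. \<Sum>j<n. G j i * wform m (q i) (p j)"
    and ?S = "(\<Sum>k<m. real (k + 1) / 4 * (\<Sum>i<n. \<Sum>j<n. G j i * ((q i k + q i (k + 1)) * (p j k + p j (k + 1)))))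
        + real (m + 1) / 2 * (\<Sum>i<n. \<Sum>j<n. G j i * (q i m * p j m))"
  have split: "?C
      = (\<Sum>k<m. real (k + 1) / 4 * (\<Sum>i<n. \<Sum>j<n. G j i * ((q i k + q i (k + 1)) * (p j k + p j (k + 1)))))
        + real (m + 1) / 2 * (\<Sum>i<n. \<Sum>j<n. G j i * (q i m * p j m))"
  proof -
    have e1: "(\<Sum>i<n. \<Sum>j<n. G j i * (\<Sum>k<m. c k * f i j k)) = (\<Sum>k<m. c k * (\<Sum>i<n. \<Sum>j<n. G j i * f i j k))"
      for c :: "nat \<Rightarrow> real" and f
      unfolding sum_distrib_left by (subst sum_swap3) (simp only: mult.left_commute)
    have e2: "(\<Sum>i<n. \<Sum>j<n. G j i * (c * f i j)) = c * (\<Sum>i<n. \<Sum>j<n. G j i * f i j)"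
      for c :: real and f
      unfolding sum_distrib_left by (simp only: mult.left_commute)
    show ?thesis
      unfolding wform_def distrib_left[of "G j i" for i j] sum.distrib e1 e2 ..
  qed
  have "\<bar>?S\<bar> \<le> (\<Sum>k<m. real (k + 1) / 4 * (\<mu> * (g k + g (k + 1)))) + real (m + 1) / 2 * (\<mu> / 2 * g m)"
  proof (intro order.trans[OF abs_triangle_ineq] add_mono order.trans[OF sum_abs] sum_mono)
    fix k assume "k \<in> {..<m}"
    let ?s = "\<Sum>i<n. \<Sum>j<n. G j i * ((q i k + q i (k + 1)) * (p j k + p j (k + 1)))"
    have "2 * \<bar>?s\<bar> \<le> \<mu> * (\<Sum>i<n. (q i k + q i (k + 1))\<^sup>2 + (p i k + p i (k + 1))\<^sup>2)"
      by (rule \<mu>)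
    also have "\<dots> \<le> \<mu> * (\<Sum>i<n. 2 * ((q i k)\<^sup>2 + (q i (k + 1))\<^sup>2) + 2 * ((p i k)\<^sup>2 + (p i (k + 1))\<^sup>2))"
    proof -
      have "(x + y)\<^sup>2 \<le> 2 * (x\<^sup>2 + y\<^sup>2)" for x y :: real
        using sum_squares_bound[of x y] by (simp add: power2_sum)
      then show ?thesis using \<mu>(1) by (intro mult_left_mono sum_mono add_mono) auto
    qed
    also have "\<dots> = 2 * (\<mu> * (g k + g (k + 1)))"
      unfolding g_def sum.distrib sum_distrib_left[symmetric] by (simp add: algebra_simps)
    finally have "\<bar>?s\<bar> \<le> \<mu> * (g k + g (k + 1))" by simp
    then show "\<bar>real (k + 1) / 4 * ?s\<bar> \<le> real (k + 1) / 4 * (\<mu> * (g k + g (k + 1)))"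
      unfolding abs_mult by (intro mult_mono) auto
  next
    have "\<bar>\<Sum>i<n. \<Sum>j<n. G j i * (q i m * p j m)\<bar> \<le> \<mu> / 2 * g m"
      using \<mu>(2)[of "\<lambda>i. q i m" "\<lambda>j. p j m"] unfolding g_def by simp
    then show "\<bar>real (m + 1) / 2 * (\<Sum>i<n. \<Sum>j<n. G j i * (q i m * p j m))\<bar> \<le> real (m + 1) / 2 * (\<mu> / 2 * g m)"
      unfolding abs_mult by (intro mult_mono) auto
  qed
  also have "\<dots> = \<mu> / 2 * ((\<Sum>k<m. real (k + 1) / 2 * (g k + g (k + 1))) + real (m + 1) / 2 * g m)"
    unfolding distrib_left[of "\<mu> / 2"] sum_distrib_left
    by (intro arg_cong2[of _ _ _ _ "(+)"] sum.cong refl) simp_all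
  \<comment> \<open>\<open>g k\<close> receives (k + 1)/2 from its right pair and k/2 from its left
    pair; for k = m the separate last term takes the place of the right pair.\<close>
  also have "\<dots> = \<mu> / 2 * (\<Sum>k\<le>m. (real k + 1 / 2) * g k)"
    by (intro arg_cong[of _ _ "(*) (\<mu> / 2)"], induction m) (auto simp: field_simps)
  also have "\<dots> \<le> \<mu> / 2 * (\<Sum>k\<le>m. (real m + 1 / 2) * g k)"
    using \<mu>(1) by (intro mult_left_mono sum_mono mult_right_mono) (auto simp: g_def intro!: sum_nonneg add_nonneg_nonneg)
  finally have "\<bar>?C\<bar> \<le> \<mu> / 2 * (real m + 1 / 2) * (\<Sum>k\<le>m. g k)"
    unfolding split by (simp only: sum_distrib_left mult.assoc)
  then show ?thesis
    unfolding cross_term_def g_def abs_mult by (intro mult_mono) auto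
qed

lemma cross_term_le_energy:
  "\<bar>cross_term q p\<bar> \<le> h * (real m + 1 / 2) * \<mu> / \<eta> * energy q p"
proof -
  let ?X = "\<Sum>k\<le>m. \<Sum>i<n. (q i k)\<^sup>2 + (p i k)\<^sup>2"
  have "\<bar>cross_term q p\<bar> \<le> h\<^sup>2 * (\<mu> / 2 * (real m + 1 / 2) * ?X)"
    by (rule cross_term_bound)
  also have "\<dots> = h * (real m + 1 / 2) * \<mu> / \<eta> * (h / 2 * \<eta> * ?X)"
    using \<eta>(1) by (simp add: power2_eq_square)
  also have "\<dots> \<le> h * (real m + 1 / 2) * \<mu> / \<eta> * energy q p"
    using h \<mu>(1) \<eta>(1) by (intro mult_left_mono energy_ge) auto
  finally show ?thesis .
qed

section \<open>Rates of the energy and of the cross term at one fixed instant\<close>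

context
  fixes a b q p q' p' :: "nat \<Rightarrow> nat \<Rightarrow> real"
  assumes left: "\<And>i. i < n \<Longrightarrow> a i 0 = 0"
    and right: "\<And>i. i < n \<Longrightarrow> b i (m + 1) = - (\<Sum>l<n. G l i * (\<kappa> l * a l (m + 1)))"
    and q: "\<And>i k. i < n \<Longrightarrow> k \<le> m \<Longrightarrow> q i k = (b i k + b i (k + 1)) / 2 / \<theta>q i k"
    and p: "\<And>i k. i < n \<Longrightarrow> k \<le> m \<Longrightarrow> p i k = (a i k + a i (k + 1)) / 2 / \<theta>p i k"
    and q': "\<And>i k. i < n \<Longrightarrow> k \<le> m \<Longrightarrow> q' i k = 1 / h * (\<Sum>j<n. A i j * (a j (k + 1) - a j k))"
    and p': "\<And>i k. i < n \<Longrightarrow> k \<le> m \<Longrightarrow> p' i k = 1 / h * (\<Sum>j<n. A j i * (b j (k + 1) - b j k))"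
begin

text \<open>Average times increment, added with the roles of \<open>a\<close> and \<open>b\<close>
  exchanged, is the increment of the product, so the sum over the elements telescopes. The left end
  drops out because \<open>a\<close> vanishes there; at the right end the boundary condition brings
  in \<open>G\<close>, which cancels \<open>A\<close>.\<close>

lemma energy_rate:
  "h * (\<Sum>i<n. \<Sum>k\<le>m. \<theta>q i k * (q i k * q' i k) + \<theta>p i k * (p i k * p' i k))
     = - (\<Sum>j<n. \<kappa> j * (a j (m + 1))\<^sup>2)"
proof -
  let ?f = "\<lambda>x i k. (x i k + x i (k + 1)) / 2" and ?d = "\<lambda>x i k. x i (k + 1) - x i k"
  have "h * (\<Sum>i<n. \<Sum>k\<le>m. \<theta>q i k * (q i k * q' i k) + \<theta>p i k * (p i k * p' i k))
     = (\<Sum>i<n. \<Sum>k\<le>m. \<Sum>j<n. A i j * (?f b i k * ?d a j k) + A j i * (?f a i k * ?d b j k))"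
    unfolding sum_distrib_left
  proof (intro sum.cong refl)
    fix i k assume "i \<in> {..<n}" "k \<in> {..m}"
    then have ik: "i < n" "k \<le> m" by auto
    have f: "\<theta>q i k * q i k = ?f b i k" "\<theta>p i k * p i k = ?f a i k"
      using q[OF ik] p[OF ik] \<theta>_pos[OF ik] by auto
    have d: "h * q' i k = (\<Sum>j<n. A i j * ?d a j k)" "h * p' i k = (\<Sum>j<n. A j i * ?d b j k)"
      using q'[OF ik] p'[OF ik] h by auto
    have "h * (\<theta>q i k * (q i k * q' i k) + \<theta>p i k * (p i k * p' i k))
       = (\<theta>q i k * q i k) * (h * q' i k) + (\<theta>p i k * p i k) * (h * p' i k)"
      by (simp add: algebra_simps)
    also have "\<dots> = (\<Sum>j<n. A i j * (?f b i k * ?d a j k)) + (\<Sum>j<n. A j i * (?f a i k * ?d b j k))"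
      unfolding f d sum_distrib_left by (simp only: mult.left_commute)
    finally show "h * (\<theta>q i k * (q i k * q' i k) + \<theta>p i k * (p i k * p' i k))
      = (\<Sum>j<n. A i j * (?f b i k * ?d a j k) + A j i * (?f a i k * ?d b j k))"
      by (simp only: sum.distrib)
  qed
  also have "\<dots> = (\<Sum>i<n. \<Sum>j<n. \<Sum>k\<le>m. A i j * (?f b i k * ?d a j k))
      + (\<Sum>i<n. \<Sum>j<n. \<Sum>k\<le>m. A j i * (?f a i k * ?d b j k))"
    unfolding sum.distrib by (intro arg_cong2[of _ _ _ _ "(+)"] sum.cong refl sum.swap)
  \<comment> \<open>Renaming i and j in the second sum gives both sums the same factor
    \<open>A i j\<close>.\<close>
  also have "\<dots> = (\<Sum>i<n. \<Sum>j<n. \<Sum>k\<le>m. A i j * (?f b i k * ?d a j k))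
      + (\<Sum>i<n. \<Sum>j<n. \<Sum>k\<le>m. A i j * (?f a j k * ?d b i k))"
    by (intro arg_cong2[of _ _ _ _ "(+)"] refl, rule sum.swap)
  also have "\<dots>
      = (\<Sum>i<n. \<Sum>j<n. A i j * (\<Sum>k\<le>m. b i (k + 1) * a j (k + 1) - b i k * a j k))"
    unfolding sum.distrib[symmetric] sum_distrib_left
    by (intro sum.cong refl) (simp add: field_simps)
  also have "\<dots> = (\<Sum>i<n. \<Sum>j<n. A i j * (b i (m + 1) * a j (m + 1)))"
  proof (intro sum.cong refl)
    fix i j assume "j \<in> {..<n}"
    then show "A i j * (\<Sum>k\<le>m. b i (k + 1) * a j (k + 1) - b i k * a j k)
       = A i j * (b i (m + 1) * a j (m + 1))"
      using sum_lessThan_telescope[of "\<lambda>k. b i k * a j k" "Suc m"] left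
      by (simp add: lessThan_Suc_atMost)
  qed
  \<comment> \<open>The boundary condition is inserted and the sum over i is moved inside to expose
    the product of \<open>G\<close> and \<open>A\<close>.\<close>
  also have "\<dots> = - (\<Sum>j<n. \<Sum>l<n. (\<Sum>i<n. G l i * A i j) * (\<kappa> l * a l (m + 1) * a j (m + 1)))"
  proof -
    have "(\<Sum>i<n. \<Sum>j<n. A i j * (b i (m + 1) * a j (m + 1)))
        = (\<Sum>i<n. \<Sum>j<n. \<Sum>l<n. - (G l i * A i j * (\<kappa> l * a l (m + 1) * a j (m + 1))))"
      using right by (intro sum.cong refl)
        (simp add: sum_distrib_left sum_distrib_right sum_negf mult_ac)
    also have "\<dots> = (\<Sum>j<n. \<Sum>l<n. \<Sum>i<n. - (G l i * A i j * (\<kappa> l * a l (m + 1) * a j (m + 1))))"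
      by (rule sum_swap3[symmetric])
    finally show ?thesis by (simp only: sum_negf sum_distrib_right)
  qed
  also have "\<dots> = - (\<Sum>j<n. \<kappa> j * (a j (m + 1))\<^sup>2)"
    by (simp add: inverse(1) power2_eq_square mult.assoc if_distrib[of "\<lambda>x. x * _"] sum.delta cong: if_cong)
  finally show ?thesis .
qed

text \<open>The factor \<open>G\<close> of the coupling undoes the mixing by \<open>A\<close> and
  its transpose in the dynamics. This leaves n decoupled pairs, each pairing a field with the
  increments of its own nodal values, which is the situation of \<open>wform_difference_le\<close>.
  The two boundary terms together are controlled by \<nu>.\<close>

lemma cross_rate:
  "h\<^sup>2 * (\<Sum>i<n. \<Sum>j<n. G j i * (wform m (q' i) (p j) + wform m (q i) (p' j)))
     \<le> h * real (m + 1) / 2 * \<nu> * (\<Sum>i<n. (a i (m + 1))\<^sup>2) - \<delta> * energy q p"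
proof -
  let ?d = "\<lambda>x i k. x i (k + 1) - x i k"
  \<comment> \<open>Here the sum over i produces the product of \<open>G\<close> and
    \<open>A\<close>; in the next claim the sum over j produces the product of \<open>A\<close> and
    \<open>G\<close>.\<close>
  have 1: "(\<Sum>i<n. \<Sum>j<n. G j i * (h * wform m (q' i) (p j))) = (\<Sum>j<n. wform m (p j) (?d a j))"
  proof -
    have "h * wform m (q' i) y = (\<Sum>l<n. A i l * wform m (?d a l) y)" if "i < n" for i y
    proof -
      have "h * wform m (q' i) y = wform m (\<lambda>k. h * q' i k) y" by (rule wform_scale_left[symmetric])
      also have "\<dots> = wform m (\<lambda>k. \<Sum>l<n. A i l * ?d a l k) y"
        using q' that h by (intro wform_cong) auto
      finally show ?thesis by (simp add: wform_sum_left)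
    qed
    then have "(\<Sum>i<n. \<Sum>j<n. G j i * (h * wform m (q' i) (p j)))
        = (\<Sum>i<n. \<Sum>j<n. \<Sum>l<n. G j i * A i l * wform m (?d a l) (p j))"
      by (simp add: sum_distrib_left mult.assoc)
    also have "\<dots> = (\<Sum>j<n. \<Sum>l<n. (\<Sum>i<n. G j i * A i l) * wform m (?d a l) (p j))"
      unfolding sum_distrib_right by (rule sum_swap3[symmetric])
    also have "\<dots> = (\<Sum>j<n. wform m (p j) (?d a j))"
      by (simp add: inverse(1) wform_commute[of m "p _"] if_distrib[of "\<lambda>x. x * _"] sum.delta cong: if_cong)
    finally show ?thesis .
  qed
  have 2: "(\<Sum>i<n. \<Sum>j<n. G j i * (h * wform m (q i) (p' j))) = (\<Sum>i<n. wform m (q i) (?d b i))"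
  proof -
    have "h * wform m y (p' j) = (\<Sum>l<n. A l j * wform m y (?d b l))" if "j < n" for j y
    proof -
      have "h * wform m (p' j) y = wform m (\<lambda>k. h * p' j k) y" by (rule wform_scale_left[symmetric])
      also have "\<dots> = wform m (\<lambda>k. \<Sum>l<n. A l j * ?d b l k) y"
        using p' that h by (intro wform_cong) auto
      finally show ?thesis by (simp add: wform_sum_left wform_commute[of m y])
    qed
    then have "(\<Sum>i<n. \<Sum>j<n. G j i * (h * wform m (q i) (p' j)))
        = (\<Sum>i<n. \<Sum>j<n. \<Sum>l<n. G j i * A l j * wform m (q i) (?d b l))"
      by (simp add: sum_distrib_left mult.assoc)
    also have "\<dots> = (\<Sum>i<n. \<Sum>l<n. (\<Sum>j<n. G j i * A l j) * wform m (q i) (?d b l))"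
      unfolding sum_distrib_right by (intro sum.cong refl sum.swap)
    also have "\<dots> = (\<Sum>i<n. wform m (q i) (?d b i))"
      by (simp add: inverse(2) if_distrib[of "\<lambda>x. x * _"] sum.delta cong: if_cong)
    finally show ?thesis .
  qed
  have bound: "wform m (y i) (?d x i) \<le> real (m + 1) / 2 * ((x i (m + 1))\<^sup>2 / \<theta> i m)
      - \<delta> / 2 * (\<Sum>k\<le>m. \<theta> i k * (y i k)\<^sup>2)"
    if "\<theta> \<in> {\<theta>q, \<theta>p}" "i < n" "\<And>k. k \<le> m \<Longrightarrow> y i k = (x i k + x i (k + 1)) / 2 / \<theta> i k" for \<theta> x y i
  proof -
    have pos: "\<theta> i k > 0" if "k \<le> m" for k
      using \<theta>_pos[OF \<open>i < n\<close> that] \<open>\<theta> \<in> {\<theta>q, \<theta>p}\<close> by auto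
    have "wform m (y i) (?d x i) \<le> real (m + 1) / 2 * ((x i (m + 1))\<^sup>2 / \<theta> i m)
     - 1 / 2 * ((\<Sum>k\<le>m. \<theta> i k * (y i k)\<^sup>2)
         - (\<Sum>k<m. real (k + 1) * (\<theta> i (k + 1) - \<theta> i k) * (y i k * y i (k + 1))))"
      by (intro wform_difference_le pos that(3))
    moreover have "w \<le> c - \<delta> / 2 * S" if "w \<le> c - 1 / 2 * D" "\<delta> * S \<le> D" for w c D S :: real
      using that by simp
    ultimately show ?thesis
      using coercive[OF that(1,2), of "y i"] by blast
  qed
  have "h\<^sup>2 * (\<Sum>i<n. \<Sum>j<n. G j i * (wform m (q' i) (p j) + wform m (q i) (p' j)))
     = h * (\<Sum>i<n. wform m (p i) (?d a i) + wform m (q i) (?d b i))"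
  proof -
    have "h * (\<Sum>i<n. \<Sum>j<n. G j i * (wform m (q' i) (p j) + wform m (q i) (p' j)))
      = (\<Sum>i<n. \<Sum>j<n. G j i * (h * wform m (q' i) (p j))) + (\<Sum>i<n. \<Sum>j<n. G j i * (h * wform m (q i) (p' j)))"
      unfolding sum_distrib_left sum.distrib[symmetric]
      by (intro sum.cong refl) (simp add: algebra_simps)
    then show ?thesis unfolding 1 2 sum.distrib by (simp add: power2_eq_square)
  qed
  also have "\<dots> \<le> h * (\<Sum>i<n. (real (m + 1) / 2 * ((a i (m + 1))\<^sup>2 / \<theta>p i m) - \<delta> / 2 * (\<Sum>k\<le>m. \<theta>p i k * (p i k)\<^sup>2))
       + (real (m + 1) / 2 * ((b i (m + 1))\<^sup>2 / \<theta>q i m) - \<delta> / 2 * (\<Sum>k\<le>m. \<theta>q i k * (q i k)\<^sup>2)))"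
    using h by (intro mult_left_mono sum_mono add_mono bound) (auto simp: p q)
  also have "\<dots> = h * real (m + 1) / 2 * (\<Sum>i<n. (b i (m + 1))\<^sup>2 / \<theta>q i m + (a i (m + 1))\<^sup>2 / \<theta>p i m)
      - \<delta> * energy q p"
    unfolding energy_def sum.distrib sum_subtractf sum_distrib_left[symmetric] by (simp add: algebra_simps)
  \<comment> \<open>The boundary condition expresses \<open>b\<close> at the right end by
    \<open>a\<close>, which turns the sum into the quadratic form of \<Psi>; the squares absorb the
    sign.\<close>
  also have "\<dots> \<le> h * real (m + 1) / 2 * (\<nu> * (\<Sum>i<n. (a i (m + 1))\<^sup>2)) - \<delta> * energy q p"
    using h \<nu>[of "\<lambda>l. a l (m + 1)"] by (intro diff_right_mono mult_left_mono) (auto simp: right[simplified])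
  finally show ?thesis by (simp only: mult.assoc)
qed

end

text \<open>Because of the factor \<open>m + 1 / 2\<close> instead of \<open>m + 1\<close>, the Lyapunov function stays equivalent
  to the energy even for \<open>\<epsilon> = \<epsilon>\<^sub>0\<close>; only the constant, not the rate, depends on \<open>m\<close>.\<close>

lemma coupling_less:
  fixes \<epsilon> :: real
  defines "\<epsilon>\<^sub>0 \<equiv> \<eta> / (h * real (m + 1) * \<mu>)"
  defines "r \<equiv> \<epsilon> * (h * (real m + 1 / 2) * \<mu> / \<eta>)"
  assumes \<epsilon>: "0 < \<epsilon>" "\<epsilon> \<le> \<epsilon>\<^sub>0"
  shows "0 < r" "r < \<epsilon> / \<epsilon>\<^sub>0" "r < 1"
proof -
  have \<epsilon>0: "\<epsilon>\<^sub>0 > 0" unfolding \<epsilon>\<^sub>0_def using h \<mu>(1) \<eta>(1) by auto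
  show "r > 0" unfolding r_def using h \<mu>(1) \<eta>(1) \<epsilon>(1) by auto
  show "r < \<epsilon> / \<epsilon>\<^sub>0"
    unfolding r_def \<epsilon>\<^sub>0_def using h \<mu>(1) \<eta>(1) \<epsilon>(1) by (simp add: divide_strict_right_mono)
  also have "\<epsilon> / \<epsilon>\<^sub>0 \<le> 1" using \<epsilon> \<epsilon>0 by simp
  finally show "r < 1" .
qed

text \<open>Two constants govern the equivalence of the Lyapunov function \<open>F\<close> and the
  energy. The sharp \<open>r\<close> depends on \<open>m\<close> and enters only the factor in
  front; for the rate it is relaxed to \<open>\<epsilon> / \<epsilon>\<^sub>0\<close>, which depends
  on the mesh only through the product \<open>h * real (m + 1)\<close>, the length of the
  interval.\<close>

lemma energy_decay:
  fixes a b q p :: "real \<Rightarrow> nat \<Rightarrow> nat \<Rightarrow> real" and \<epsilon> :: real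
  defines "\<epsilon>\<^sub>0 \<equiv> \<eta> / (h * real (m + 1) * \<mu>)"
  defines "r \<equiv> \<epsilon> * (h * (real m + 1 / 2) * \<mu> / \<eta>)"
  assumes \<epsilon>: "0 < \<epsilon>" "\<epsilon> \<le> \<epsilon>\<^sub>0" "\<epsilon> * (h * real (m + 1) * \<nu>) \<le> 2 * \<eta>\<^sub>K"
    and left: "\<And>t i. t \<ge> 0 \<Longrightarrow> i < n \<Longrightarrow> a t i 0 = 0"
    and right: "\<And>t i. t \<ge> 0 \<Longrightarrow> i < n \<Longrightarrow> b t i (m + 1) = - (\<Sum>l<n. G l i * (\<kappa> l * a t l (m + 1)))"
    and q: "\<And>t i k. t \<ge> 0 \<Longrightarrow> i < n \<Longrightarrow> k \<le> m \<Longrightarrow> q t i k = (b t i k + b t i (k + 1)) / 2 / \<theta>q i k"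
    and p: "\<And>t i k. t \<ge> 0 \<Longrightarrow> i < n \<Longrightarrow> k \<le> m \<Longrightarrow> p t i k = (a t i k + a t i (k + 1)) / 2 / \<theta>p i k"
    and q': "\<And>t i k. t \<ge> 0 \<Longrightarrow> i < n \<Longrightarrow> k \<le> m \<Longrightarrow>
      ((\<lambda>s. q s i k) has_real_derivative 1 / h * (\<Sum>j<n. A i j * (a t j (k + 1) - a t j k))) (at t within {0..})"
    and p': "\<And>t i k. t \<ge> 0 \<Longrightarrow> i < n \<Longrightarrow> k \<le> m \<Longrightarrow>
      ((\<lambda>s. p s i k) has_real_derivative 1 / h * (\<Sum>j<n. A j i * (b t j (k + 1) - b t j k))) (at t within {0..})"
    and t: "t \<ge> 0"
  shows "energy (q t) (p t)
      \<le> (1 + r) / (1 - r) * exp (- (\<delta> * \<epsilon> * \<epsilon>\<^sub>0 / (\<epsilon> + \<epsilon>\<^sub>0)) * t) * energy (q 0) (p 0)"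
proof -
  define \<alpha> where "\<alpha> = \<delta> * \<epsilon> * \<epsilon>\<^sub>0 / (\<epsilon> + \<epsilon>\<^sub>0)"
  define F where "F t = energy (q t) (p t) + \<epsilon> * cross_term (q t) (p t)" for t
  have \<epsilon>0: "\<epsilon>\<^sub>0 > 0" unfolding \<epsilon>\<^sub>0_def using h \<mu>(1) \<eta>(1) by auto
  have r: "r < \<epsilon> / \<epsilon>\<^sub>0" "r < 1"
    unfolding r_def \<epsilon>\<^sub>0_def using coupling_less \<epsilon>(1,2) unfolding \<epsilon>\<^sub>0_def by blast+
  have cross: "\<bar>\<epsilon> * cross_term x y\<bar> \<le> r * energy x y" for x y
    using mult_left_mono[OF cross_term_le_energy[of x y] less_imp_le[OF \<epsilon>(1)]] \<epsilon>(1)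
    unfolding r_def by (simp add: abs_mult mult.assoc)
  have F_le: "F t \<le> (1 + r) * energy (q t) (p t)" and F_ge: "(1 - r) * energy (q t) (p t) \<le> F t" for t
    using cross[of "q t" "p t"] unfolding F_def by (auto simp: algebra_simps abs_le_iff)
  define q1 where "q1 t i k = 1 / h * (\<Sum>j<n. A i j * (a t j (k + 1) - a t j k))" for t i k
  define p1 where "p1 t i k = 1 / h * (\<Sum>j<n. A j i * (b t j (k + 1) - b t j k))" for t i k
  define F' where "F' t = h * (\<Sum>i<n. \<Sum>k\<le>m. \<theta>q i k * (q t i k * q1 t i k) + \<theta>p i k * (p t i k * p1 t i k))
      + \<epsilon> * (h\<^sup>2 * (\<Sum>i<n. \<Sum>j<n. G j i * (wform m (q1 t i) (p t j) + wform m (q t i) (p1 t j))))" for t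
  have deriv: "(F has_real_derivative F' t) (at t within {0..})" if t: "t \<ge> 0" for t
  proof -
    have sq: "((\<lambda>s. (f s)\<^sup>2) has_real_derivative 2 * (f t * f')) (at t within {0..})"
      if "(f has_real_derivative f') (at t within {0..})" for f' :: real and f
      using that by (auto intro!: derivative_eq_intros)
    have D1: "((\<lambda>s. energy (q s) (p s)) has_real_derivative
        h / 2 * (\<Sum>i<n. \<Sum>k\<le>m. \<theta>q i k * (2 * (q t i k * q1 t i k)) + \<theta>p i k * (2 * (p t i k * p1 t i k))))
        (at t within {0..})"
      unfolding energy_def q1_def p1_def
      by (intro DERIV_cmult DERIV_sum DERIV_add sq q' p' t) auto
    have eq: "h / 2 * (\<Sum>i<n. \<Sum>k\<le>m. \<theta>q i k * (2 * (q t i k * q1 t i k)) + \<theta>p i k * (2 * (p t i k * p1 t i k)))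
      = h * (\<Sum>i<n. \<Sum>k\<le>m. \<theta>q i k * (q t i k * q1 t i k) + \<theta>p i k * (p t i k * p1 t i k))"
      unfolding sum_distrib_left by (intro sum.cong refl) (simp add: algebra_simps)
    have D2: "((\<lambda>s. cross_term (q s) (p s)) has_real_derivative
        h\<^sup>2 * (\<Sum>i<n. \<Sum>j<n. G j i * (wform m (q1 t i) (p t j) + wform m (q t i) (p1 t j)))) (at t within {0..})"
      unfolding cross_term_def q1_def p1_def
      by (intro DERIV_cmult DERIV_sum has_real_derivative_wform q' p' t) auto
    show ?thesis
      unfolding F_def F'_def by (rule DERIV_add[OF D1[unfolded eq] DERIV_cmult[OF D2]])
  qed
  have rate: "F' t \<le> - \<alpha> * F t" if t: "t \<ge> 0" for t
  proof -
    let ?e = "\<Sum>j<n. (a t j (m + 1))\<^sup>2"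
    have 1: "h * (\<Sum>i<n. \<Sum>k\<le>m. \<theta>q i k * (q t i k * q1 t i k) + \<theta>p i k * (p t i k * p1 t i k))
        = - (\<Sum>j<n. \<kappa> j * (a t j (m + 1))\<^sup>2)"
      by (rule energy_rate[of "a t" "b t"]) (use t left right q p in \<open>auto simp: q1_def p1_def\<close>)
    have "\<eta>\<^sub>K * ?e \<le> (\<Sum>j<n. \<kappa> j * (a t j (m + 1))\<^sup>2)"
      unfolding sum_distrib_left by (intro sum_mono mult_right_mono \<eta>\<^sub>K) auto
    moreover have "h\<^sup>2 * (\<Sum>i<n. \<Sum>j<n. G j i * (wform m (q1 t i) (p t j) + wform m (q t i) (p1 t j)))
        \<le> h * real (m + 1) / 2 * \<nu> * ?e - \<delta> * energy (q t) (p t)"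
      by (rule cross_rate[of "a t" "b t"]) (use t left right q p in \<open>auto simp: q1_def p1_def\<close>)
    then have "\<epsilon> * (h\<^sup>2 * (\<Sum>i<n. \<Sum>j<n. G j i * (wform m (q1 t i) (p t j) + wform m (q t i) (p1 t j))))
        \<le> \<epsilon> * (h * real (m + 1) / 2 * \<nu> * ?e - \<delta> * energy (q t) (p t))"
      using \<epsilon>(1) by (intro mult_left_mono) auto
    ultimately have "F' t \<le> - (\<eta>\<^sub>K * ?e) + \<epsilon> * (h * real (m + 1) / 2 * \<nu> * ?e - \<delta> * energy (q t) (p t))"
      unfolding F'_def 1 by linarith
    also have "\<dots> = (\<epsilon> * (h * real (m + 1) * \<nu>) - 2 * \<eta>\<^sub>K) / 2 * ?e - \<epsilon> * \<delta> * energy (q t) (p t)"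
      by (simp add: field_simps)
    also have "\<dots> \<le> - (\<delta> * \<epsilon> * energy (q t) (p t))"
    proof -
      \<comment> \<open>The sign of this coefficient is the content of
        \<open>\<epsilon> \<le> \<epsilon>\<^sub>1\<close>: the boundary term of the coupling is
        dominated by the dissipation.\<close>
      have "(\<epsilon> * (h * real (m + 1) * \<nu>) - 2 * \<eta>\<^sub>K) / 2 * ?e \<le> 0"
        using \<epsilon>(3) by (intro mult_nonpos_nonneg sum_nonneg) auto
      then show ?thesis by (simp add: mult.commute)
    qed
    also have "\<dots> = - (\<alpha> * ((1 + \<epsilon> / \<epsilon>\<^sub>0) * energy (q t) (p t)))"
    proof -
      \<comment> \<open>This equation is the origin of the rate.\<close>
      have "\<delta> * \<epsilon> = \<alpha> * (1 + \<epsilon> / \<epsilon>\<^sub>0)"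
        unfolding \<alpha>_def using \<epsilon>(1) \<epsilon>0 by (simp add: divide_simps)
      then show ?thesis by simp
    qed
    also have "\<dots> \<le> - (\<alpha> * F t)"
    proof -
      have "F t \<le> (1 + \<epsilon> / \<epsilon>\<^sub>0) * energy (q t) (p t)"
        using F_le[of t] r(1) energy_nonneg[of "q t" "p t"]
        by (smt (verit) mult_right_mono)
      then show ?thesis unfolding \<alpha>_def using \<delta> \<epsilon>(1) \<epsilon>0 by (intro le_imp_neg_le mult_left_mono) auto
    qed
    finally show ?thesis by simp
  qed
  have "(1 - r) * energy (q t) (p t) \<le> F t" by (rule F_ge)
  also have "F t \<le> exp (- \<alpha> * t) * F 0" by (rule exp_decay[OF deriv rate t])
  also have "\<dots> \<le> exp (- \<alpha> * t) * ((1 + r) * energy (q 0) (p 0))"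
    by (intro mult_left_mono F_le) auto
  finally show "energy (q t) (p t)
      \<le> (1 + r) / (1 - r) * exp (- (\<delta> * \<epsilon> * \<epsilon>\<^sub>0 / (\<epsilon> + \<epsilon>\<^sub>0)) * t) * energy (q 0) (p 0)"
    using r(2) unfolding \<alpha>_def[symmetric] by (simp add: field_simps)
qed

end

section \<open>Rayleigh quotients\<close>

text \<open>A crude constant suffices: it makes the set of Rayleigh quotients bounded and, applied
  to an inverse matrix, gives a gap. The summand 1 makes it strictly positive, so that one can
  divide by it.\<close>

lemma quadratic_form_bounded:
  fixes A :: "real mat"
  assumes A: "A \<in> carrier_mat n n"
  shows "\<exists>C>0. \<forall>v\<in>carrier_vec n. \<bar>v \<bullet> (A *\<^sub>v v)\<bar> \<le> C * (v \<bullet> v)"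
proof (intro exI conjI ballI)
  let ?C = "1 + (\<Sum>i<n. \<Sum>j<n. \<bar>A $$ (i, j)\<bar>)"
  show "?C > 0"
    by (intro add_pos_nonneg sum_nonneg) auto
  fix v :: "real vec" assume v: "v \<in> carrier_vec n"
  have vv: "v \<bullet> v = (\<Sum>i<n. (v $ i)\<^sup>2)"
    using v by (auto simp: scalar_prod_def power2_eq_square atLeast0LessThan)
  have sq: "(v $ i)\<^sup>2 \<le> v \<bullet> v" if "i < n" for i
    unfolding vv using that by (intro member_le_sum) auto
  have prod: "\<bar>v $ i * v $ j\<bar> \<le> v \<bullet> v" if "i < n" "j < n" for i j
  proof -
    have "2 * \<bar>v $ i * v $ j\<bar> \<le> (v $ i)\<^sup>2 + (v $ j)\<^sup>2"
      using sum_squares_bound[of "\<bar>v $ i\<bar>" "\<bar>v $ j\<bar>"] by (simp add: abs_mult)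
    then show ?thesis using sq[OF that(1)] sq[OF that(2)] by linarith
  qed
  have "v \<bullet> (A *\<^sub>v v) = (\<Sum>i<n. \<Sum>j<n. A $$ (i, j) * (v $ i * v $ j))"
    using A v by (auto simp: scalar_prod_def atLeast0LessThan sum_distrib_left intro!: sum.cong)
  also have "\<bar>\<dots>\<bar> \<le> (\<Sum>i<n. \<Sum>j<n. \<bar>A $$ (i, j)\<bar> * (v \<bullet> v))"
    by (intro order.trans[OF sum_abs] sum_mono) (auto simp: abs_mult[of "A $$ _"] intro!: mult_left_mono prod)
  also have "\<dots> \<le> ?C * (v \<bullet> v)"
    by (simp add: sum_distrib_right distrib_right vv sum_nonneg)
  finally show "\<bar>v \<bullet> (A *\<^sub>v v)\<bar> \<le> ?C * (v \<bullet> v)" .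
qed

lemma quadratic_form_symmetric:
  fixes A :: "real mat"
  assumes A: "A \<in> carrier_mat n n" "transpose_mat A = A" and "v \<in> carrier_vec n" "w \<in> carrier_vec n"
  shows "v \<bullet> (A *\<^sub>v w) = w \<bullet> (A *\<^sub>v v)"
  using assms transpose_vec_mult_scalar[of A n n w v]
  by (metis comm_scalar_prod mult_mat_vec_carrier)

lemma semidefinite_Cauchy_Schwarz:
  fixes B :: "real mat"
  assumes B: "B \<in> carrier_mat n n" "transpose_mat B = B"
    and psd: "\<And>v. v \<in> carrier_vec n \<Longrightarrow> 0 \<le> v \<bullet> (B *\<^sub>v v)"
    and v: "v \<in> carrier_vec n" and w: "w \<in> carrier_vec n"
  shows "(v \<bullet> (B *\<^sub>v w))\<^sup>2 \<le> (v \<bullet> (B *\<^sub>v v)) * (w \<bullet> (B *\<^sub>v w))"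
proof -
  let ?a = "v \<bullet> (B *\<^sub>v v)" and ?b = "v \<bullet> (B *\<^sub>v w)" and ?c = "w \<bullet> (B *\<^sub>v w)"
  have q: "0 \<le> ?a + 2 * t * ?b + t\<^sup>2 * ?c" for t
  proof -
    have "0 \<le> (v + t \<cdot>\<^sub>v w) \<bullet> (B *\<^sub>v (v + t \<cdot>\<^sub>v w))"
      using v w by (intro psd) auto
    also have "\<dots> = ?a + 2 * t * ?b + t\<^sup>2 * ?c"
      using v w B quadratic_form_symmetric[OF B w v]
      by (simp add: mult_add_distrib_mat_vec[OF B(1)] mult_mat_vec[OF B(1)] add_scalar_prod_distrib[of _ n]
          scalar_prod_add_distrib[of _ n] power2_eq_square algebra_simps)
    finally show ?thesis .
  qed
  show ?thesis
  proof (cases "?c = 0")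
    case True
    have "?b = 0"
    proof (rule ccontr)
      assume "?b \<noteq> 0"
      \<comment> \<open>If \<open>?c\<close> vanishes, the quadratic in t is affine; this t gives it
        the value -1.\<close>
      then show False using q[of "- (?a + 1) / (2 * ?b)"] True by (simp add: field_simps)
    qed
    then show ?thesis using True by simp
  next
    case False
    then have "?c > 0" using psd[OF w] by simp
    then show ?thesis using q[of "- ?b / ?c"]
      by (simp add: field_simps power2_eq_square)
  qed
qed

text \<open>If the supremum \<open>s\<close> of the Rayleigh quotient were not an eigenvalue, then \<open>s - A\<close> would be
  semidefinite and invertible, hence coercive by Cauchy--Schwarz, and \<open>s\<close> could be lowered.\<close>

lemma Rayleigh_le_max_eig:
  fixes A :: "real mat"
  assumes A: "A \<in> carrier_mat n n" "transpose_mat A = A" and v: "v \<in> carrier_vec n"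
  shows "v \<bullet> (A *\<^sub>v v) \<le> max_eig A * (v \<bullet> v)"
\<comment> \<open>The zero vector also covers n = 0, where the spectrum is empty and
  \<open>Max\<close> is unspecified.\<close>
proof (cases "v = 0\<^sub>v n")
  case True
  then show ?thesis using A by auto
next
  case False
  have pos: "u \<bullet> u > 0" if "u \<in> carrier_vec n" "u \<noteq> 0\<^sub>v n" for u :: "real vec"
  proof -
    have "(\<Sum>i\<in>{0..<n}. u $ i * u $ i) \<noteq> 0"
      using that by (subst sum_nonneg_eq_0_iff) (auto intro!: eq_vecI)
    moreover have "(\<Sum>i\<in>{0..<n}. u $ i * u $ i) \<ge> 0"
      by (intro sum_nonneg) auto
    ultimately show ?thesis using that(1) by (auto simp: scalar_prod_def)
  qed
  define S where "S = {u \<bullet> (A *\<^sub>v u) / (u \<bullet> u) | u. u \<in> carrier_vec n \<and> u \<noteq> 0\<^sub>v n}"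
  define s where "s = Sup S"
  have ne: "S \<noteq> {}" using v False unfolding S_def by auto
  obtain C where C: "\<forall>u\<in>carrier_vec n. \<bar>u \<bullet> (A *\<^sub>v u)\<bar> \<le> C * (u \<bullet> u)"
    using quadratic_form_bounded[OF A(1)] by auto
  have bdd: "bdd_above S"
  proof (rule bdd_aboveI)
    fix x assume "x \<in> S"
    then obtain u where u: "u \<in> carrier_vec n" "u \<noteq> 0\<^sub>v n" "x = u \<bullet> (A *\<^sub>v u) / (u \<bullet> u)"
      unfolding S_def by auto
    then show "x \<le> C" using C pos[OF u(1,2)] by (auto simp: divide_le_eq abs_le_iff)
  qed
  have le: "u \<bullet> (A *\<^sub>v u) \<le> s * (u \<bullet> u)" if u: "u \<in> carrier_vec n" for u
  proof (cases "u = 0\<^sub>v n")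
    case True
    then show ?thesis using A by auto
  next
    case False
    then have "u \<bullet> (A *\<^sub>v u) / (u \<bullet> u) \<le> s"
      unfolding s_def by (intro cSup_upper bdd) (auto simp: S_def u)
    then show ?thesis using pos[OF u False] by (simp add: divide_le_eq)
  qed
  have "eigenvalue A s"
  proof (rule ccontr)
    assume "\<not> eigenvalue A s"
    define B where "B = s \<cdot>\<^sub>m 1\<^sub>m n - A"
    have B: "B \<in> carrier_mat n n" "transpose_mat B = B"
    proof -
      show "B \<in> carrier_mat n n" using A unfolding B_def by auto
      have sym: "A $$ (i, j) = A $$ (j, i)" if "i < n" "j < n" for i j
        using that A by (metis carrier_matD index_transpose_mat(1))
      show "transpose_mat B = B" unfolding B_def
        by (rule eq_matI) (use A sym in auto)
    qed
    have Bv: "u \<bullet> (B *\<^sub>v u) = s * (u \<bullet> u) - u \<bullet> (A *\<^sub>v u)" if u: "u \<in> carrier_vec n" for u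
    proof -
      have "B *\<^sub>v u = s \<cdot>\<^sub>v u - A *\<^sub>v u"
        unfolding B_def using A u by (subst minus_mult_distrib_mat_vec) auto
      then show ?thesis using A u by (simp add: scalar_prod_minus_distrib[of _ n])
    qed
    have "det B \<noteq> 0"
    proof
      assume "det B = 0"
      then obtain u where u: "u \<in> carrier_vec n" "u \<noteq> 0\<^sub>v n" "B *\<^sub>v u = 0\<^sub>v n"
        using det_0_iff_vec_prod_zero[OF B(1)] by auto
      have "B *\<^sub>v u = s \<cdot>\<^sub>v u - A *\<^sub>v u"
        unfolding B_def using A u by (subst minus_mult_distrib_mat_vec) auto
      then have z: "s \<cdot>\<^sub>v u - A *\<^sub>v u = 0\<^sub>v n" using u by simp
      have "A *\<^sub>v u = s \<cdot>\<^sub>v u"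
      proof (rule eq_vecI)
        fix i assume "i < dim_vec (s \<cdot>\<^sub>v u)"
        then show "(A *\<^sub>v u) $ i = (s \<cdot>\<^sub>v u) $ i"
          using arg_cong[OF z, of "\<lambda>w. w $ i"] A u by auto
      qed (use A u in auto)
      then have "eigenvalue A s" unfolding eigenvalue_def eigenvector_def using u A by auto
      then show False using \<open>\<not> eigenvalue A s\<close> by simp
    qed
    then obtain G where G: "G \<in> carrier_mat n n" "B * G = 1\<^sub>m n"
      using det_non_zero_imp_unit[OF B(1), of undefined] unfolding Units_def by (auto simp: ring_mat_simps)
    obtain c where c: "c > 0" "\<forall>u\<in>carrier_vec n. \<bar>u \<bullet> (G *\<^sub>v u)\<bar> \<le> c * (u \<bullet> u)"
      using quadratic_form_bounded[OF G(1)] by auto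
    have "s \<le> s - 1 / c" unfolding s_def
    proof (rule cSup_least[OF ne], fold s_def)
      fix x assume "x \<in> S"
      then obtain u where u: "u \<in> carrier_vec n" "u \<noteq> 0\<^sub>v n" "x = u \<bullet> (A *\<^sub>v u) / (u \<bullet> u)"
        unfolding S_def by auto
      have Gu: "B *\<^sub>v (G *\<^sub>v u) = u"
        using B G u by (metis assoc_mult_mat_vec one_mult_mat_vec)
      \<comment> \<open>Cauchy-Schwarz for the form of \<open>B\<close> with second vector
        \<open>G *\<^sub>v u\<close>, which \<open>B\<close> maps to \<open>u\<close>. Bounding the
        last factor by c times the square of the length of \<open>u\<close> keeps all Rayleigh
        quotients below s - 1/c.\<close>
      have "(u \<bullet> u)\<^sup>2 \<le> (u \<bullet> (B *\<^sub>v u)) * ((G *\<^sub>v u) \<bullet> u)"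
        using semidefinite_Cauchy_Schwarz[OF B _ u(1), of "G *\<^sub>v u"] Bv le G u Gu by auto
      also have "\<dots> \<le> (u \<bullet> (B *\<^sub>v u)) * (c * (u \<bullet> u))"
        using c u G Bv le comm_scalar_prod[of "G *\<^sub>v u" n u]
        by (intro mult_left_mono) (auto simp: abs_le_iff)
      finally have "u \<bullet> u \<le> (u \<bullet> (B *\<^sub>v u)) * c"
        using pos[OF u(1,2)] by (simp add: power2_eq_square)
      then show "x \<le> s - 1 / c" 
        using pos[OF u(1,2)] c(1) unfolding Bv[OF u(1)] u(3) by (simp add: field_simps)
    qed
    then show False using c by simp
  qed
  then have "s \<le> max_eig A"
    unfolding max_eig_def using card_finite_spectrum[OF A(1)] by (intro Max_ge) (auto simp: spectrum_def)
  moreover have "v \<bullet> v \<ge> 0" using pos[OF v False] by simp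
  ultimately show ?thesis using le[OF v] by (meson mult_right_mono order_trans)
qed

section \<open>Diagonal matrices and Kronecker products\<close>

text \<open>For square matrices a right inverse is two-sided and unique, so \<open>minv\<close> can
  be identified without following the elimination behind \<open>mat_inverse\<close>.\<close>

lemma minv_eqI:
  fixes A :: "'a :: field mat"
  assumes A: "A \<in> carrier_mat n n" and B: "B \<in> carrier_mat n n" and AB: "A * B = 1\<^sub>m n"
  shows "minv A = B"
proof -
  have BA: "B * A = 1\<^sub>m n" by (rule mat_mult_left_right_inverse[OF A B AB])
  have "A \<in> Units (ring_mat TYPE('a) n undefined)"
    using A B AB BA unfolding Units_def by (auto simp: ring_mat_simps)
  then obtain C where C: "mat_inverse A = Some C"
    using mat_inverse(1)[OF A, of undefined] by (cases "mat_inverse A") auto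
  then have AC: "A * C = 1\<^sub>m n" "C \<in> carrier_mat n n"
    using mat_inverse(2)[OF A] by auto
  have "C = (B * A) * C" using AC BA by simp
  also have "\<dots> = B * (A * C)" using A B AC by (intro assoc_mult_mat) auto
  also have "\<dots> = B" using AC B by simp
  finally show ?thesis unfolding minv_def C by simp
qed

lemma minv_invertible:
  fixes A :: "'a :: field mat"
  assumes A: "A \<in> carrier_mat n n" and inv: "invertible_mat A"
  shows "minv A \<in> carrier_mat n n" "A * minv A = 1\<^sub>m n" "minv A * A = 1\<^sub>m n"
proof -
  obtain B where B: "A * B = 1\<^sub>m (dim_row A)" "B * A = 1\<^sub>m (dim_row B)"
    using inv unfolding invertible_mat_def inverts_mat_def by auto
  have "dim_col (A * B) = n" using B(1) A by (metis carrier_matD(1) index_one_mat(3))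
  moreover have "dim_col (B * A) = dim_row B" using B(2) by (metis index_one_mat(3))
  ultimately have Bc: "B \<in> carrier_mat n n" using A by auto
  then have "minv A = B" using minv_eqI[OF A Bc] B A by auto
  then show "minv A \<in> carrier_mat n n" "A * minv A = 1\<^sub>m n" "minv A * A = 1\<^sub>m n"
    using B Bc A by auto
qed

lemma transpose_minv:
  fixes A :: "'a :: field mat"
  assumes A: "A \<in> carrier_mat n n" and inv: "invertible_mat A"
  shows "transpose_mat A * transpose_mat (minv A) = 1\<^sub>m n"
  using minv_invertible[OF assms] A by (metis transpose_mult transpose_one)

lemma smult_mat_mult_vec:
  fixes B :: "'a :: comm_semiring_0 mat"
  assumes "B \<in> carrier_mat m n" "v \<in> carrier_vec n"
  shows "(c \<cdot>\<^sub>m B) *\<^sub>v v = c \<cdot>\<^sub>v (B *\<^sub>v v)"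
  using assms by (intro eq_vecI) (auto simp: scalar_prod_def sum_distrib_left mult.assoc)

lemma minv_mat_diag:
  fixes d :: "nat \<Rightarrow> 'a :: field"
  assumes "\<And>i. i < n \<Longrightarrow> d i \<noteq> 0"
  shows "minv (mat_diag n d) = mat_diag n (\<lambda>i. 1 / d i)"
proof (rule minv_eqI[of _ n])
  have "mat_diag n (\<lambda>i. d i * (1 / d i)) = mat_diag n (\<lambda>_. 1)"
    using assms by (auto simp: mat_diag_def intro!: eq_matI)
  then show "mat_diag n d * mat_diag n (\<lambda>i. 1 / d i) = 1\<^sub>m n" by simp
qed auto

lemma mat_diag_mult_vec:
  assumes "v \<in> carrier_vec n"
  shows "mat_diag n d *\<^sub>v v = vec n (\<lambda>i. d i * v $ i)"
proof (rule eq_vecI)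
  fix i assume "i < dim_vec (vec n (\<lambda>i. d i * v $ i))"
  then have i: "i < n" by simp
  have "(mat_diag n d *\<^sub>v v) $ i = (\<Sum>j\<in>{0..<n}. (if i = j then d j else 0) * v $ j)"
    using i assms by (simp add: mat_diag_def scalar_prod_def)
  also have "\<dots> = (\<Sum>j\<in>{0..<n}. if i = j then d j * v $ j else 0)"
    by (intro sum.cong) auto
  finally have "(mat_diag n d *\<^sub>v v) $ i = \<dots>" .
  then show "(mat_diag n d *\<^sub>v v) $ i = vec n (\<lambda>i. d i * v $ i) $ i" using i by simp
qed (simp add: mat_diag_def)

lemma spectrum_mat_diag:
  fixes d :: "nat \<Rightarrow> 'a :: field"
  shows "spectrum (mat_diag n d) = d ` {..<n}"
proof (intro equalityI subsetI)
  fix c assume "c \<in> spectrum (mat_diag n d)"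
  then obtain v where v: "v \<in> carrier_vec n" "v \<noteq> 0\<^sub>v n" "mat_diag n d *\<^sub>v v = c \<cdot>\<^sub>v v"
    unfolding spectrum_def eigenvalue_def eigenvector_def by (auto simp: mat_diag_def)
  then obtain i where i: "i < n" "v $ i \<noteq> 0" by (metis carrier_vecD eq_vecI index_zero_vec)
  have "d i * v $ i = c * v $ i"
    using arg_cong[OF v(3), of "\<lambda>w. w $ i"] i v(1) by (simp add: mat_diag_mult_vec)
  then have "c = d i" using i by simp
  then show "c \<in> d ` {..<n}" using i by simp
next
  fix c assume "c \<in> d ` {..<n}"
  then obtain i where i: "i < n" "c = d i" by auto
  have "mat_diag n d *\<^sub>v unit_vec n i = c \<cdot>\<^sub>v unit_vec n i"
    using i by (auto simp: mat_diag_mult_vec intro!: eq_vecI)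
  then show "c \<in> spectrum (mat_diag n d)"
    using i unit_vec_nonzero[OF i(1)] unfolding spectrum_def eigenvalue_def eigenvector_def
    by (auto simp: mat_diag_def intro!: exI[of _ "unit_vec n i"])
qed

lemma min_eig_mat_diag: "min_eig (mat_diag n d) = Min (d ` {..<n})"
  unfolding min_eig_def spectrum_mat_diag ..

lemma four_block_mat_diag:
  "four_block_mat (mat_diag n d) (0\<^sub>m n m) (0\<^sub>m m n) (mat_diag m e)
     = mat_diag (n + m) (\<lambda>i. if i < n then d i else e (i - n))"
  by (rule eq_matI) (auto simp: mat_diag_def)

section \<open>Block indices and Kronecker products\<close>

lemma block_index:
  fixes i k n N :: nat
  assumes "i < n" "k < N"
  shows "i * N + k < n * N"
proof -
  have "i * N + k < Suc i * N" using assms(2) by simp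
  also have "\<dots> \<le> n * N" using assms(1) by (intro mult_le_mono1) simp
  finally show ?thesis .
qed

lemma sum_blocks:
  fixes f :: "nat \<Rightarrow> 'a :: comm_monoid_add"
  shows "(\<Sum>r<n * N. f r) = (\<Sum>i<n. \<Sum>k<N. f (i * N + k))"
proof -
  have "(\<Sum>r<n * N. f r) = (\<Sum>i<n. sum f {i * N..<i * N + N})"
    by (rule sum.nat_group[symmetric])
  moreover have "sum f {i * N..<i * N + N} = (\<Sum>k<N. f (i * N + k))" for i
    using sum.shift_bounds_nat_ivl[of f 0 "i * N" N] by (simp add: atLeast0LessThan add.commute)
  ultimately show ?thesis by simp
qed

lemma diag_block_mat_diag:
  "diag_block_mat (map (\<lambda>x. mat_diag N (g x)) xs)
     = mat_diag (length xs * N) (\<lambda>r. g (xs ! (r div N)) (r mod N))"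
proof (induction xs)
  case Nil
  show ?case by (rule eq_matI) (auto simp: mat_diag_def)
next
  case (Cons x xs)
  have *: "(\<lambda>r. g (xs ! (r div N)) (r mod N)) (r - N) = g ((x # xs) ! (r div N)) (r mod N)"
    if "\<not> r < N" "r < N + length xs * N" for r
    using that by (cases "N = 0") (auto simp: le_div_geq le_mod_geq)
  have "diag_block_mat (map (\<lambda>x. mat_diag N (g x)) (x # xs))
     = four_block_mat (mat_diag N (g x)) (0\<^sub>m N (length xs * N)) (0\<^sub>m (length xs * N) N)
         (mat_diag (length xs * N) (\<lambda>r. g (xs ! (r div N)) (r mod N)))"
    by (simp add: Cons.IH Let_def) (simp add: mat_diag_def)
  also have "\<dots> = mat_diag (length (x # xs) * N) (\<lambda>r. g ((x # xs) ! (r div N)) (r mod N))"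
    unfolding four_block_mat_diag using * by (auto simp: mat_diag_def intro!: eq_matI)
  finally show ?case .
qed

lemma dim_kron [simp]:
  "dim_row (kron A B) = dim_row A * dim_row B" "dim_col (kron A B) = dim_col A * dim_col B"
  by (simp_all add: kron_def)

lemma kron_carrier: "A \<in> carrier_mat m n \<Longrightarrow> B \<in> carrier_mat p q \<Longrightarrow> kron A B \<in> carrier_mat (m * p) (n * q)"
  by (auto simp: kron_def)

lemma index_kron:
  assumes "A \<in> carrier_mat m n" "B \<in> carrier_mat p q" "i < m" "k < p" "j < n" "l < q"
  shows "kron A B $$ (i * p + k, j * q + l) = A $$ (i, j) * B $$ (k, l)"
  using assms block_index[of i m k p] block_index[of j n l q] by (auto simp: kron_def)

lemma mat_block_eqI:
  assumes X: "X \<in> carrier_mat (m * p) (n * q)" and Y: "Y \<in> carrier_mat (m * p) (n * q)"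
    and eq: "\<And>i k j l. i < m \<Longrightarrow> k < p \<Longrightarrow> j < n \<Longrightarrow> l < q \<Longrightarrow>
      X $$ (i * p + k, j * q + l) = Y $$ (i * p + k, j * q + l)"
  shows "X = Y"
proof (rule eq_matI)
  fix r c assume "r < dim_row Y" "c < dim_col Y"
  then have rc: "r < m * p" "c < n * q" using Y by auto
  then have "p > 0" "q > 0" by (auto intro: gr0I)
  with rc have "r div p < m" "r mod p < p" "c div q < n" "c mod q < q"
    by (auto simp: less_mult_imp_div_less)
  from eq[OF this] show "X $$ (r, c) = Y $$ (r, c)" by simp
qed (use X Y in auto)

lemma kron_mult_vec:
  assumes A: "A \<in> carrier_mat m n" and B: "B \<in> carrier_mat p q" and v: "v \<in> carrier_vec (n * q)"
    and ik: "i < m" "k < p"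
  shows "(kron A B *\<^sub>v v) $ (i * p + k) = (\<Sum>j<n. \<Sum>l<q. A $$ (i, j) * B $$ (k, l) * v $ (j * q + l))"
proof -
  have "(kron A B *\<^sub>v v) $ (i * p + k) = (\<Sum>c<n * q. kron A B $$ (i * p + k, c) * v $ c)"
    using A B v block_index[OF ik] by (simp add: scalar_prod_def atLeast0LessThan)
  then show ?thesis
    unfolding sum_blocks by (simp add: index_kron[OF A B ik])
qed

lemma kron_mult:
  fixes A B C D :: "'a :: comm_semiring_0 mat"
  assumes A: "A \<in> carrier_mat m n" and B: "B \<in> carrier_mat p q"
    and C: "C \<in> carrier_mat n r" and D: "D \<in> carrier_mat q s"
  shows "kron A B * kron C D = kron (A * C) (B * D)"
proof (rule mat_block_eqI[where m = m and p = p and n = r and q = s])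
  fix i k j l assume *: "i < m" "k < p" "j < r" "l < s"
  have "(kron A B * kron C D) $$ (i * p + k, j * s + l)
      = (\<Sum>c<n * q. kron A B $$ (i * p + k, c) * kron C D $$ (c, j * s + l))"
    using A B C D block_index[OF *(1,2)] block_index[OF *(3,4)]
    by (simp add: scalar_prod_def atLeast0LessThan)
  also have "\<dots> = (\<Sum>x<n. \<Sum>y<q. (A $$ (i, x) * C $$ (x, j)) * (B $$ (k, y) * D $$ (y, l)))"
    unfolding sum_blocks using * by (simp add: index_kron[OF A B] index_kron[OF C D] mult_ac)
  also have "\<dots> = (A * C) $$ (i, j) * (B * D) $$ (k, l)"
    unfolding sum_product[symmetric]
    using A B C D * by (auto simp: scalar_prod_def atLeast0LessThan)
  finally show "(kron A B * kron C D) $$ (i * p + k, j * s + l) = kron (A * C) (B * D) $$ (i * p + k, j * s + l)"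
    using A B C D * index_kron[of "A * C" m r "B * D" p s i k j l] by auto
qed (use A B C D in \<open>auto simp: kron_def\<close>)

lemma transpose_kron: "transpose_mat (kron A B) = kron (transpose_mat A) (transpose_mat B)"
proof (rule mat_block_eqI[where m = "dim_col A" and p = "dim_col B" and n = "dim_row A" and q = "dim_row B"])
  fix i k j l assume "i < dim_col A" "k < dim_col B" "j < dim_row A" "l < dim_row B"
  then show "transpose_mat (kron A B) $$ (i * dim_col B + k, j * dim_row B + l)
      = kron (transpose_mat A) (transpose_mat B) $$ (i * dim_col B + k, j * dim_row B + l)"
    using index_kron[of A "dim_row A" "dim_col A" B "dim_row B" "dim_col B" j l i k]
      index_kron[of "transpose_mat A" "dim_col A" "dim_row A" "transpose_mat B" "dim_col B" "dim_row B" i k j l]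
      block_index[of i "dim_col A" k "dim_col B"] block_index[of j "dim_row A" l "dim_row B"]
    by auto
qed auto

lemma kron_one: "kron (1\<^sub>m n) (1\<^sub>m N) = (1\<^sub>m (n * N) :: 'a :: semiring_1 mat)"
proof (rule mat_block_eqI[where m = n and p = N and n = n and q = N])
  fix i k j l assume *: "i < n" "k < N" "j < n" "l < N"
  have "i * N + k = j * N + l \<longleftrightarrow> i = j \<and> k = l"
    using * by (metis add.commute mod_less mod_mult_self1 mult_right_cancel add_right_cancel gr_implies_not0)
  then show "kron (1\<^sub>m n) (1\<^sub>m N) $$ (i * N + k, j * N + l) = (1\<^sub>m (n * N) :: 'a mat) $$ (i * N + k, j * N + l)"
    using * index_kron[of "1\<^sub>m n :: 'a mat" n n "1\<^sub>m N" N N i k j l]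
      block_index[of i n k N] block_index[of j n l N] by auto
qed (auto simp: kron_def)

lemma minv_kron_one:
  fixes A :: "'a :: field mat"
  assumes A: "A \<in> carrier_mat n n" and inv: "invertible_mat A"
  shows "minv (kron A (1\<^sub>m N)) = kron (minv A) (1\<^sub>m N)"
proof (rule minv_eqI)
  show "kron A (1\<^sub>m N) \<in> carrier_mat (n * N) (n * N)" "kron (minv A) (1\<^sub>m N) \<in> carrier_mat (n * N) (n * N)"
    using A minv_invertible[OF assms] by (auto intro: kron_carrier)
  show "kron A (1\<^sub>m N) * kron (minv A) (1\<^sub>m N) = 1\<^sub>m (n * N)"
    using A minv_invertible[OF assms] by (simp add: kron_mult[of _ n n _ N N _ n _ N] kron_one)
qed

section \<open>The one-dimensional matrices as averages, differences and end values\<close>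

lemma M_mat_carrier: "M_mat N \<in> carrier_mat N N" and D_mat_carrier: "D_mat N \<in> carrier_mat N N"
  by (auto simp: M_mat_def D_mat_def L_mat_def)

lemma index_M_mat:
  "k < N \<Longrightarrow> l < N \<Longrightarrow> M_mat N $$ (k, l) = (if l = k then 1 / 2 else 0) + (if l = Suc k then 1 / 2 else 0)"
  and index_D_mat:
  "k < N \<Longrightarrow> l < N \<Longrightarrow> D_mat N $$ (k, l) = (if l = k then 1 else 0) - (if k = Suc l then 1 else 0)"
  by (auto simp: M_mat_def D_mat_def L_mat_def)

text \<open>A neighbour missing at the end of the grid counts as 0: on the right for M and the
  transpose of D, on the left for D and the transpose of M. On the left this is the boundary
  condition; on the right \<open>B1_bar\<close> and \<open>B2_bar\<close> supply the true
  value.\<close>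

lemma sum_M_mat:
  "k < N \<Longrightarrow> (\<Sum>l<N. M_mat N $$ (k, l) * v l) = (v k + (if Suc k = N then 0 else v (Suc k))) / 2"
  by (auto simp: index_M_mat distrib_right sum.distrib if_distrib[of "\<lambda>x. x * _"] sum.delta add_divide_distrib
      cong: if_cong)

lemma sum_M_mat_transpose:
  "k < N \<Longrightarrow> (\<Sum>l<N. M_mat N $$ (l, k) * v l) = (v k + (case k of 0 \<Rightarrow> 0 | Suc j \<Rightarrow> v j)) / 2"
  by (cases k) (auto simp: index_M_mat distrib_right sum.distrib if_distrib[of "\<lambda>x. x * _"] sum.delta
      sum.delta' add_divide_distrib cong: if_cong)

lemma sum_D_mat:
  "k < N \<Longrightarrow> (\<Sum>l<N. D_mat N $$ (k, l) * v l) = v k - (case k of 0 \<Rightarrow> 0 | Suc j \<Rightarrow> v j)"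
  by (cases k) (auto simp: index_D_mat left_diff_distrib sum_subtractf if_distrib[of "\<lambda>x. x * _"] sum.delta
      sum.delta' cong: if_cong)

lemma sum_D_mat_transpose:
  "k < N \<Longrightarrow> (\<Sum>l<N. D_mat N $$ (l, k) * v l) = v k - (if Suc k = N then 0 else v (Suc k))"
  by (auto simp: index_D_mat left_diff_distrib sum_subtractf if_distrib[of "\<lambda>x. x * _"] sum.delta
      sum.delta' cong: if_cong)

lemma index_tr_mat:
  assumes "k < N" "l < N"
  shows "(tr_mat N * transpose_mat (tr_mat N)) $$ (k, l) = (if Suc k = N then if Suc l = N then 1 else 0 else 0)"
  using assms by (auto simp: tr_mat_def scalar_prod_def)

lemma sum_tr_mat:
  "k < N \<Longrightarrow> (\<Sum>l<N. (tr_mat N * transpose_mat (tr_mat N)) $$ (k, l) * v l) = (if Suc k = N then v k else 0)"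
  by (cases N) (auto simp: index_tr_mat if_distrib[of "\<lambda>x. x * _"] sum.delta sum.delta' cong: if_cong)

section \<open>The constants\<close>

lemma eta_K_le:
  assumes "n \<ge> 1" and \<kappa>: "\<And>i. i < n \<Longrightarrow> 0 < \<kappa> i"
  shows "0 < eta_K n \<kappa>" "i < n \<Longrightarrow> eta_K n \<kappa> \<le> \<kappa> i"
proof -
  have "Min (\<kappa> ` {..<n}) \<in> \<kappa> ` {..<n}"
    using \<open>n \<ge> 1\<close> by (intro Min_in) (auto simp: lessThan_empty_iff)
  then show "0 < eta_K n \<kappa>"
    unfolding eta_K_def K_mat_def min_eig_mat_diag using \<kappa> by auto
  show "i < n \<Longrightarrow> eta_K n \<kappa> \<le> \<kappa> i"
    unfolding eta_K_def K_mat_def min_eig_mat_diag by (intro Min_le) auto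
qed

text \<open>Pointwise positivity passes to the infimum only as \<open>0 \<le>\<close>; the strict
  inequality is later read off from the positivity of \<open>eps0\<close>, which a nonempty range of
  \<epsilon> entails.\<close>

lemma eta_Theta_le:
  assumes "n \<ge> 1" "xl < xr"
    and pos: "\<And>\<theta> i x. \<theta> \<in> {\<theta>q, \<theta>p} \<Longrightarrow> i < n \<Longrightarrow> x \<in> {xl..xr} \<Longrightarrow> 0 < \<theta> i x"
  shows "0 \<le> eta_Theta xl xr n \<theta>q \<theta>p"
    and "\<theta> \<in> {\<theta>q, \<theta>p} \<Longrightarrow> i < n \<Longrightarrow> x \<in> {xl..xr} \<Longrightarrow> eta_Theta xl xr n \<theta>q \<theta>p \<le> \<theta> i x"
proof -
  let ?d = "\<lambda>x i. if i < n then \<theta>q i x else \<theta>p (i - n) x"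
  have min: "min_eig (Theta_mat n \<theta>q \<theta>p x) = Min (?d x ` {..<n + n})" for x
    unfolding Theta_mat_def four_block_mat_diag min_eig_mat_diag ..
  have nonneg: "0 \<le> min_eig (Theta_mat n \<theta>q \<theta>p x)" if x: "x \<in> {xl..xr}" for x
  proof -
    have "Min (?d x ` {..<n + n}) \<in> ?d x ` {..<n + n}"
      using \<open>n \<ge> 1\<close> by (intro Min_in) (auto simp: lessThan_empty_iff)
    then obtain i where i: "Min (?d x ` {..<n + n}) = ?d x i" "i \<in> {..<n + n}" by (rule imageE)
    show ?thesis unfolding min i(1) using i(2) pos[of \<theta>q i x] pos[of \<theta>p "i - n" x] x
      by (auto simp: less_imp_le)
  qed
  show "0 \<le> eta_Theta xl xr n \<theta>q \<theta>p"
    unfolding eta_Theta_def using \<open>xl < xr\<close> nonneg by (intro cINF_greatest) auto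
  assume *: "\<theta> \<in> {\<theta>q, \<theta>p}" "i < n" "x \<in> {xl..xr}"
  have "eta_Theta xl xr n \<theta>q \<theta>p \<le> min_eig (Theta_mat n \<theta>q \<theta>p x)"
    unfolding eta_Theta_def using nonneg * by (intro cINF_lower bdd_belowI[of _ 0]) auto
  also have "\<dots> \<le> \<theta> i x"
  proof -
    have "\<theta>q i x \<in> ?d x ` {..<n + n}" using * by (intro image_eqI[of _ _ i]) auto
    moreover have "\<theta>p i x \<in> ?d x ` {..<n + n}" using * by (intro image_eqI[of _ _ "n + i"]) auto
    ultimately show ?thesis unfolding min using * by (auto intro!: Min_le)
  qed
  finally show "eta_Theta xl xr n \<theta>q \<theta>p \<le> \<theta> i x" .
qed

text \<open>Cauchy-Schwarz and the identity of the squared length of \<open>S *\<^sub>v v\<close>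
  with the quadratic form of the square of \<open>S\<close> reduce the two-sided bound to a
  one-sided Rayleigh bound.\<close>

lemma abs_quadratic_form_le_sqrt_max_eig:
  fixes S :: "real mat"
  assumes S: "S \<in> carrier_mat n n" "transpose_mat S = S" and v: "v \<in> carrier_vec n"
  shows "\<bar>v \<bullet> (S *\<^sub>v v)\<bar> \<le> sqrt (max_eig (S ^\<^sub>m 2)) * (v \<bullet> v)"
proof -
  have S2: "S ^\<^sub>m 2 = S * S" using S by (simp add: numeral_2_eq_2)
  have nonneg: "0 \<le> u \<bullet> u" for u :: "real vec"
    unfolding scalar_prod_def by (intro sum_nonneg) auto
  have Sv: "S *\<^sub>v v \<in> carrier_vec n" using S v by auto
  have "(v \<bullet> (S *\<^sub>v v))\<^sup>2 \<le> (v \<bullet> v) * ((S *\<^sub>v v) \<bullet> (S *\<^sub>v v))"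
    using semidefinite_Cauchy_Schwarz[of "1\<^sub>m n" n v "S *\<^sub>v v"] v Sv nonneg by simp
  moreover have "(S *\<^sub>v v) \<bullet> (S *\<^sub>v v) = v \<bullet> ((S * S) *\<^sub>v v)"
    using quadratic_form_symmetric[OF S v Sv] S v by simp
  moreover have "v \<bullet> ((S * S) *\<^sub>v v) \<le> max_eig (S ^\<^sub>m 2) * (v \<bullet> v)"
    unfolding S2 using S v by (intro Rayleigh_le_max_eig) (auto simp: transpose_mult[OF S(1) S(1)])
  ultimately have "(v \<bullet> (S *\<^sub>v v))\<^sup>2 \<le> (v \<bullet> v) * (max_eig (S ^\<^sub>m 2) * (v \<bullet> v))"
    using mult_left_mono[OF _ nonneg[of v]] by (metis order.trans)
  then have "(v \<bullet> (S *\<^sub>v v))\<^sup>2 \<le> max_eig (S ^\<^sub>m 2) * (v \<bullet> v)\<^sup>2"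
    by (simp add: power2_eq_square mult_ac)
  then have "sqrt ((v \<bullet> (S *\<^sub>v v))\<^sup>2) \<le> sqrt (max_eig (S ^\<^sub>m 2) * (v \<bullet> v)\<^sup>2)"
    by (rule real_sqrt_le_mono)
  then show ?thesis using nonneg by (simp add: real_sqrt_mult)
qed

text \<open>The inverse of P_1 has the off-diagonal blocks A^-T and A^-1, so its quadratic form at
  (x, y) counts the coupling twice.\<close>

lemma mu_P1_bound:
  assumes A: "A \<in> carrier_mat n n" and inv: "invertible_mat A"
  shows "2 * \<bar>\<Sum>i<n. \<Sum>j<n. minv A $$ (j, i) * (x i * y j)\<bar> \<le> mu_P1 n A * (\<Sum>i<n. (x i)\<^sup>2 + (y i)\<^sup>2)"
proof -
  let ?G = "minv A"
  note G = minv_invertible[OF assms]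
  define S where "S = four_block_mat (0\<^sub>m n n) (transpose_mat ?G) ?G (0\<^sub>m n n)"
  define v where "v = vec n x @\<^sub>v vec n y"
  have S: "S \<in> carrier_mat (n + n) (n + n)" "transpose_mat S = S"
    unfolding S_def using G(1) by (auto simp: transpose_four_block_mat)
  have v: "v \<in> carrier_vec (n + n)" unfolding v_def by auto
  have "minv (P1_mat n A) = S"
  proof (rule minv_eqI[OF _ S(1)])
    show "P1_mat n A \<in> carrier_mat (n + n) (n + n)" unfolding P1_mat_def by auto
    have "P1_mat n A * S = four_block_mat (A * ?G) (0\<^sub>m n n) (0\<^sub>m n n) (transpose_mat A * transpose_mat ?G)"
      unfolding P1_mat_def S_def using A G(1) by (subst mult_four_block_mat) auto
    also have "\<dots> = 1\<^sub>m (n + n)" using transpose_minv[OF assms] G(2) by (auto intro!: eq_matI)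
    finally show "P1_mat n A * S = 1\<^sub>m (n + n)" .
  qed
  then have mu: "mu_P1 n A = sqrt (max_eig (S ^\<^sub>m 2))" unfolding mu_P1_def by simp
  have 1: "vec n x \<bullet> (transpose_mat ?G *\<^sub>v vec n y) = (\<Sum>i<n. \<Sum>j<n. ?G $$ (j, i) * (x i * y j))"
    using G(1) by (auto simp: scalar_prod_def atLeast0LessThan sum_distrib_left mult_ac intro!: sum.cong)
  have 2: "vec n y \<bullet> (?G *\<^sub>v vec n x) = (\<Sum>i<n. \<Sum>j<n. ?G $$ (j, i) * (x i * y j))"
    unfolding 1[symmetric] using transpose_vec_mult_scalar[OF G(1), of "vec n x" "vec n y"] G(1)
    by (simp add: comm_scalar_prod[of "vec n x" n])
  have "S *\<^sub>v v = (transpose_mat ?G *\<^sub>v vec n y) @\<^sub>v (?G *\<^sub>v vec n x)"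
    unfolding S_def v_def using G(1) by (subst four_block_mat_mult_vec[of _ n n _ n _ n]) auto
  then have "v \<bullet> (S *\<^sub>v v) = 2 * (\<Sum>i<n. \<Sum>j<n. ?G $$ (j, i) * (x i * y j))"
    unfolding v_def using G(1) 1 2 by (simp add: scalar_prod_append[of _ n _ n])
  moreover have "v \<bullet> v = (\<Sum>i<n. (x i)\<^sup>2 + (y i)\<^sup>2)"
    unfolding v_def scalar_prod_append[OF vec_carrier vec_carrier vec_carrier vec_carrier]
    by (simp add: scalar_prod_def atLeast0LessThan power2_eq_square sum.distrib)
  ultimately show ?thesis
    using abs_quadratic_form_le_sqrt_max_eig[OF S v] mu by (simp add: abs_mult)
qed

lemma sum_lessThan_add: "(\<Sum>r<a + b. f r) = (\<Sum>r<a. f r) + (\<Sum>r<b. f (a + r))"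
  for f :: "nat \<Rightarrow> 'a :: comm_monoid_add"
  by (induction b) (auto simp: add_ac)

text \<open>The stacked matrix in \<Psi> maps y to (A^-T K y, y), which up to sign are the values of
  both fields at the right end; the left side is therefore the quadratic form of \<Psi> at
  y.\<close>

lemma mu_Psi_bound:
  assumes A: "A \<in> carrier_mat n n" and inv: "invertible_mat A"
    and pos: "\<And>i. i < n \<Longrightarrow> \<theta>q i xr \<noteq> 0" "\<And>i. i < n \<Longrightarrow> \<theta>p i xr \<noteq> 0"
  shows "(\<Sum>i<n. (\<Sum>l<n. minv A $$ (l, i) * (\<kappa> l * y l))\<^sup>2 / \<theta>q i xr + (y i)\<^sup>2 / \<theta>p i xr)
     \<le> mu_Psi xr n A \<kappa> \<theta>q \<theta>p * (\<Sum>i<n. (y i)\<^sup>2)"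
proof -
  note G = minv_invertible[OF A inv]
  define B where "B = transpose_mat (minv A) * K_mat n \<kappa>"
  define C where "C = B @\<^sub>r 1\<^sub>m n"
  define d where "d i = (if i < n then \<theta>q i xr else \<theta>p (i - n) xr)" for i
  define W where "W = mat_diag (n + n) (\<lambda>i. 1 / d i)"
  have B: "B \<in> carrier_mat n n" unfolding B_def K_mat_def using G by auto
  have C: "C \<in> carrier_mat (n + n) n" unfolding C_def using B by auto
  have W: "W \<in> carrier_mat (n + n) (n + n)" "transpose_mat W = W"
    unfolding W_def by (auto simp: mat_diag_def intro!: eq_matI)
  have "minv (Theta_mat n \<theta>q \<theta>p xr) = W"
    unfolding Theta_mat_def four_block_mat_diag W_def d_def
    using pos by (subst minv_mat_diag) auto
  then have Psi: "Psi_mat xr n A \<kappa> \<theta>q \<theta>p = transpose_mat C * W * C"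
    unfolding Psi_mat_def Let_def C_def B_def by simp
  let ?v = "vec n y"
  have Cv: "C *\<^sub>v ?v = (B *\<^sub>v ?v) @\<^sub>v ?v"
    unfolding C_def using B by (subst mat_mult_append[of _ n n _ n]) auto
  have Bv: "(B *\<^sub>v ?v) $ i = (\<Sum>l<n. minv A $$ (l, i) * (\<kappa> l * y l))" if "i < n" for i
  proof -
    have "B *\<^sub>v ?v = transpose_mat (minv A) *\<^sub>v vec n (\<lambda>l. \<kappa> l * y l)"
      unfolding B_def K_mat_def using G(1)
      by (subst assoc_mult_mat_vec[of _ n n _ n]) (auto simp: mat_diag_mult_vec intro!: arg_cong2[of _ _ _ _ "(*\<^sub>v)"])
    then show ?thesis using that G(1) by (simp add: scalar_prod_def atLeast0LessThan)
  qed
  have "?v \<bullet> ((transpose_mat C * W * C) *\<^sub>v ?v) = (C *\<^sub>v ?v) \<bullet> (W *\<^sub>v (C *\<^sub>v ?v))"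
  proof -
    have "(transpose_mat C * W * C) *\<^sub>v ?v = (transpose_mat C * W) *\<^sub>v (C *\<^sub>v ?v)"
      by (rule assoc_mult_mat_vec) (use C W in auto)
    also have "\<dots> = transpose_mat C *\<^sub>v (W *\<^sub>v (C *\<^sub>v ?v))"
      by (rule assoc_mult_mat_vec) (use C W in auto)
    finally show ?thesis
      using C W transpose_vec_mult_scalar[OF C, of ?v "W *\<^sub>v (C *\<^sub>v ?v)"]
        comm_scalar_prod[of ?v n "transpose_mat C *\<^sub>v (W *\<^sub>v (C *\<^sub>v ?v))"]
        comm_scalar_prod[of "C *\<^sub>v ?v" "n + n" "W *\<^sub>v (C *\<^sub>v ?v)"]
      by auto
  qed
  also have "\<dots> = (\<Sum>r<n + n. ((C *\<^sub>v ?v) $ r)\<^sup>2 / d r)"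
    unfolding W_def using C
    by (simp add: mat_diag_mult_vec scalar_prod_def atLeast0LessThan power2_eq_square)
  also have "\<dots> = (\<Sum>i<n. (\<Sum>l<n. minv A $$ (l, i) * (\<kappa> l * y l))\<^sup>2 / \<theta>q i xr + (y i)\<^sup>2 / \<theta>p i xr)"
    unfolding sum_lessThan_add Cv sum.distrib using B Bv by (simp add: d_def)
  finally have eq: "?v \<bullet> ((transpose_mat C * W * C) *\<^sub>v ?v) = \<dots>" .
  have "?v \<bullet> ((transpose_mat C * W * C) *\<^sub>v ?v) \<le> max_eig (transpose_mat C * W * C) * (?v \<bullet> ?v)"
  proof (rule Rayleigh_le_max_eig)
    have "transpose_mat (transpose_mat C * W * C) = transpose_mat C * transpose_mat (transpose_mat C * W)"
      by (rule transpose_mult) (use C W in auto)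
    also have "transpose_mat (transpose_mat C * W) = transpose_mat W * transpose_mat (transpose_mat C)"
      by (rule transpose_mult) (use C W in auto)
    also have "transpose_mat C * \<dots> = transpose_mat C * W * C"
      unfolding W(2) transpose_transpose
      by (rule assoc_mult_mat[symmetric]) (use C W in auto)
    finally show "transpose_mat (transpose_mat C * W * C) = transpose_mat C * W * C" .
  qed (use C W in auto)
  moreover have "?v \<bullet> ?v = (\<Sum>i<n. (y i)\<^sup>2)"
    by (simp add: scalar_prod_def atLeast0LessThan power2_eq_square)
  ultimately show ?thesis unfolding eq mu_Psi_def Psi by simp
qed

lemma sum_superdiagonal:
  fixes f :: "nat \<Rightarrow> 'a :: comm_monoid_add"
  shows "(\<Sum>r\<le>m. \<Sum>c\<le>m. if c = r + 1 then f r else 0) = (\<Sum>k<m. f k)"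
proof -
  have "(\<Sum>r\<le>m. \<Sum>c\<le>m. if c = r + 1 then f r else 0) = (\<Sum>r\<le>m. if r < m then f r else 0)"
    by (intro sum.cong) (auto simp: sum.delta)
  also have "\<dots> = (\<Sum>k<m. f k)"
    by (intro sum.mono_neutral_cong_right) auto
  finally show ?thesis .
qed

text \<open>The two off-diagonals of \<open>O_disc\<close> contribute equally, which cancels the
  factor 1/2 in their entries and gives the defect of \<open>wform_difference_le\<close>.\<close>

lemma psd_coercive:
  assumes psd: "psd (Theta_disc xl xr (Suc m) \<theta> - O_disc xl xr (Suc m) \<theta> - \<delta> \<cdot>\<^sub>m Theta_disc xl xr (Suc m) \<theta>)"
  defines "\<tau> \<equiv> \<lambda>k. \<theta> (node xl xr (Suc m) (k + 1))"
  shows "\<delta> * (\<Sum>k\<le>m. \<tau> k * (p k)\<^sup>2)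
    \<le> (\<Sum>k\<le>m. \<tau> k * (p k)\<^sup>2) - (\<Sum>k<m. real (k + 1) * (\<tau> (k + 1) - \<tau> k) * (p k * p (k + 1)))"
proof -
  let ?X = "Theta_disc xl xr (Suc m) \<theta> - O_disc xl xr (Suc m) \<theta> - \<delta> \<cdot>\<^sub>m Theta_disc xl xr (Suc m) \<theta>"
  let ?v = "vec (Suc m) p"
  \<comment> \<open>\<open>\<tau>\<close> is shifted by one against the grid, so \<open>w k\<close>
    is the entry k of \<open>O_disc\<close>. It occurs only for k >= 1, where \<open>k - 1\<close>
    is not truncated.\<close>
  define w where "w k = real k / 2 * (\<tau> k - \<tau> (k - 1))" for k
  have X: "?X $$ (r, c) = (if r = c then (1 - \<delta>) * \<tau> c else 0)
      - ((if c = r + 1 then w (r + 1) else 0) + (if r = c + 1 then w (c + 1) else 0))" if "r \<le> m" "c \<le> m" for r c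
    using that by (auto simp: Theta_disc_def O_disc_def mat_diag_def Let_def w_def \<tau>_def algebra_simps)
  have dim: "dim_row ?X = Suc m" "dim_col ?X = Suc m" by (auto simp: Theta_disc_def O_disc_def mat_diag_def Let_def)
  have "0 \<le> ?v \<bullet> (?X *\<^sub>v ?v)" using psd dim unfolding psd_def by auto
  also have "?v \<bullet> (?X *\<^sub>v ?v) = (\<Sum>r\<le>m. \<Sum>c\<le>m. p r * (?X $$ (r, c) * p c))"
    unfolding scalar_prod_def using dim
    by (simp add: scalar_prod_def sum_distrib_left atLeast0LessThan lessThan_Suc_atMost del: index_minus_mat)
  also have "\<dots> = (\<Sum>r\<le>m. \<Sum>c\<le>m. (if r = c then (1 - \<delta>) * \<tau> c * (p c)\<^sup>2 else 0)
      - ((if c = r + 1 then w (r + 1) * (p r * p (r + 1)) else 0)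
        + (if r = c + 1 then w (c + 1) * (p c * p (c + 1)) else 0)))"
    by (intro sum.cong refl) (simp add: X power2_eq_square del: index_minus_mat)
  also have "\<dots> = (1 - \<delta>) * (\<Sum>k\<le>m. \<tau> k * (p k)\<^sup>2) - 2 * (\<Sum>k<m. w (k + 1) * (p k * p (k + 1)))"
  proof -
    have "(\<Sum>r\<le>m. \<Sum>c\<le>m. if r = c + 1 then w (c + 1) * (p c * p (c + 1)) else 0)
        = (\<Sum>k<m. w (k + 1) * (p k * p (k + 1)))"
      by (subst sum.swap) (rule sum_superdiagonal)
    then show ?thesis
      unfolding sum_subtractf sum.distrib sum_superdiagonal
      by (simp add: sum_distrib_left mult.assoc)
  qed
  also have "2 * (\<Sum>k<m. w (k + 1) * (p k * p (k + 1)))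
      = (\<Sum>k<m. real (k + 1) * (\<tau> (k + 1) - \<tau> k) * (p k * p (k + 1)))"
    unfolding sum_distrib_left by (intro sum.cong refl) (simp add: w_def)
  finally show ?thesis by (simp add: algebra_simps)
qed

section \<open>The discretized system\<close>

text \<open>Nodal values \<open>k = 0, \<dots>, N\<close>, completed by the boundary values that the matrices encode
  implicitly: \<open>e\<^sup>p = 0\<close> at the left end, and \<open>e\<^sup>q = - A\<^sup>-\<^sup>T K e\<^sup>p\<close> at the right end.\<close>

definition p_node :: "nat \<Rightarrow> real vec \<Rightarrow> nat \<Rightarrow> nat \<Rightarrow> real" where
  "p_node N w i k = (case k of 0 \<Rightarrow> 0 | Suc j \<Rightarrow> w $ (i * N + j))"

definition q_node ::
  "nat \<Rightarrow> real mat \<Rightarrow> (nat \<Rightarrow> real) \<Rightarrow> nat \<Rightarrow> real vec \<Rightarrow> real vec \<Rightarrow> nat \<Rightarrow> nat \<Rightarrow> real" where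
  "q_node n A \<kappa> N u w i k = (if k < N then u $ (i * N + k)
     else - (\<Sum>l<n. minv A $$ (l, i) * (\<kappa> l * p_node N w l N)))"

lemma kron_mult_vec':
  assumes "A \<in> carrier_mat m n" "B \<in> carrier_mat p q" "v \<in> carrier_vec (n * q)" "i < m" "k < p"
  shows "(kron A B *\<^sub>v v) $ (i * p + k) = (\<Sum>j<n. A $$ (i, j) * (\<Sum>l<q. B $$ (k, l) * v $ (j * q + l)))"
  unfolding kron_mult_vec[OF assms] by (simp add: sum_distrib_left mult.assoc)

lemma sum_one_mat:
  fixes f :: "nat \<Rightarrow> 'a :: semiring_1"
  assumes "i < n"
  shows "(\<Sum>j<n. 1\<^sub>m n $$ (i, j) * f j) = f i"
proof -
  have "(\<Sum>j<n. 1\<^sub>m n $$ (i, j) * f j) = (\<Sum>j<n. if i = j then f j else 0)"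
    using assms by (intro sum.cong) auto
  then show ?thesis using assms by simp
qed

lemma B2_carrier: "tr_mat N * transpose_mat (tr_mat N) \<in> carrier_mat N N"
  by (auto simp: tr_mat_def)

lemma K_mat_carrier: "K_mat n \<kappa> \<in> carrier_mat n n"
  by (simp add: K_mat_def)

context
  fixes n N :: nat and A :: "real mat" and \<kappa> :: "nat \<Rightarrow> real"
  assumes A: "A \<in> carrier_mat n n" and inv: "invertible_mat A"
begin

lemma B1_bar_eq:
  "B1_bar n A \<kappa> N = (1 / 2) \<cdot>\<^sub>m kron (transpose_mat (minv A) * K_mat n \<kappa>) (tr_mat N * transpose_mat (tr_mat N))"
proof -
  note G = minv_invertible[OF A inv]
  have "transpose_mat (minv (A_bar A N)) * B2_bar n \<kappa> N
    = kron (transpose_mat (minv A)) (1\<^sub>m N) * kron (K_mat n \<kappa>) (tr_mat N * transpose_mat (tr_mat N))"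
    unfolding A_bar_def B2_bar_def minv_kron_one[OF A inv] transpose_kron by simp
  also have "\<dots> = kron (transpose_mat (minv A) * K_mat n \<kappa>) (1\<^sub>m N * (tr_mat N * transpose_mat (tr_mat N)))"
    by (rule kron_mult[where m = n and n = n and p = N and q = N and r = n and s = N])
      (use G(1) B2_carrier in \<open>auto simp: K_mat_def\<close>)
  finally show ?thesis unfolding B1_bar_def left_mult_one_mat[OF B2_carrier] by simp
qed

lemma block_carriers:
  "M_bar n N \<in> carrier_mat (n * N) (n * N)" "B1_bar n A \<kappa> N \<in> carrier_mat (n * N) (n * N)"
  "A_bar A N \<in> carrier_mat (n * N) (n * N)" "D_bar n N \<in> carrier_mat (n * N) (n * N)"
  "B2_bar n \<kappa> N \<in> carrier_mat (n * N) (n * N)"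
proof -
  have "transpose_mat (minv A) * K_mat n \<kappa> \<in> carrier_mat n n"
    using minv_invertible(1)[OF A inv] K_mat_carrier by auto
  then show "B1_bar n A \<kappa> N \<in> carrier_mat (n * N) (n * N)"
    unfolding B1_bar_eq by (intro smult_carrier_mat kron_carrier B2_carrier)
  show "M_bar n N \<in> carrier_mat (n * N) (n * N)" "A_bar A N \<in> carrier_mat (n * N) (n * N)"
    "D_bar n N \<in> carrier_mat (n * N) (n * N)" "B2_bar n \<kappa> N \<in> carrier_mat (n * N) (n * N)"
    unfolding M_bar_def A_bar_def D_bar_def B2_bar_def
    by (intro kron_carrier one_carrier_mat M_mat_carrier D_mat_carrier A K_mat_carrier B2_carrier)+
qed

lemma E_mat_carrier: "E_mat n A \<kappa> N \<in> carrier_mat (n * N + n * N) (n * N + n * N)"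
  and J_mat_carrier: "J_mat n A \<kappa> N \<in> carrier_mat (n * N + n * N) (n * N + n * N)"
  unfolding E_mat_def J_mat_def using block_carriers by (auto intro!: four_block_carrier_mat)

context
  fixes u w :: "real vec"
  assumes u: "u \<in> carrier_vec (n * N)" and w: "w \<in> carrier_vec (n * N)"
begin

lemma B1_bar_mult_vec:
  assumes ik: "i < n" "k < N"
  shows "(B1_bar n A \<kappa> N *\<^sub>v w) $ (i * N + k)
    = (if Suc k = N then 1 / 2 * (\<Sum>l<n. minv A $$ (l, i) * (\<kappa> l * p_node N w l N)) else 0)"
proof -
  note G = minv_invertible[OF A inv]
  let ?X = "transpose_mat (minv A) * K_mat n \<kappa>"
  have X: "?X \<in> carrier_mat n n" using G K_mat_carrier by auto
  have Xi: "?X $$ (i, j) = minv A $$ (j, i) * \<kappa> j" if "j < n" for j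
    unfolding K_mat_def using that ik G(1) by (subst mat_diag_mult_right[of _ n]) auto
  have "(B1_bar n A \<kappa> N *\<^sub>v w) $ (i * N + k)
      = 1 / 2 * (kron ?X (tr_mat N * transpose_mat (tr_mat N)) *\<^sub>v w) $ (i * N + k)"
    unfolding B1_bar_eq smult_mat_mult_vec[OF kron_carrier[OF X B2_carrier] w]
    using carrier_matD(1)[OF kron_carrier[OF X B2_carrier]] block_index[OF ik] by (simp del: index_mult_mat_vec dim_kron)
  also have "\<dots> = 1 / 2 * (\<Sum>j<n. minv A $$ (j, i) * \<kappa> j * (if Suc k = N then w $ (j * N + k) else 0))"
    unfolding kron_mult_vec'[OF X B2_carrier w ik] sum_tr_mat[OF ik(2)] using Xi by simp
  finally show ?thesis by (auto simp: p_node_def mult.assoc)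
qed

lemma E_mat_mult_vec:
  "E_mat n A \<kappa> N *\<^sub>v (u @\<^sub>v w)
     = (M_bar n N *\<^sub>v u - B1_bar n A \<kappa> N *\<^sub>v w) @\<^sub>v (transpose_mat (M_bar n N) *\<^sub>v w)"
proof -
  have "(- B1_bar n A \<kappa> N) *\<^sub>v w = - (B1_bar n A \<kappa> N *\<^sub>v w)"
    using block_carriers w by (intro uminus_mult_mat_vec) auto
  then show ?thesis
    unfolding E_mat_def using block_carriers u w
    by (subst four_block_mat_mult_vec[of _ "n * N" "n * N" _ "n * N" _ "n * N"]) (auto intro!: eq_vecI)
qed

text \<open>In the last element \<open>M_bar\<close> lacks the right neighbour, and the factor 1/2
  in \<open>B1_bar\<close> makes it contribute exactly half of the boundary value. Thus one
  averaging formula serves all elements.\<close>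

lemma E_mat_mult_vec_q:
  assumes ik: "i < n" "k < N"
  shows "(E_mat n A \<kappa> N *\<^sub>v (u @\<^sub>v w)) $ (i * N + k)
    = (q_node n A \<kappa> N u w i k + q_node n A \<kappa> N u w i (k + 1)) / 2"
proof -
  have "(M_bar n N *\<^sub>v u) $ (i * N + k)
      = (\<Sum>j<n. 1\<^sub>m n $$ (i, j) * ((u $ (j * N + k) + (if Suc k = N then 0 else u $ (j * N + Suc k))) / 2))"
    unfolding M_bar_def kron_mult_vec'[OF one_carrier_mat M_mat_carrier u ik] sum_M_mat[OF ik(2)] ..
  also have "\<dots> = (u $ (i * N + k) + (if Suc k = N then 0 else u $ (i * N + Suc k))) / 2"
    by (rule sum_one_mat[OF ik(1)])
  finally have M: "(M_bar n N *\<^sub>v u) $ (i * N + k) = \<dots>" .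
  have "(E_mat n A \<kappa> N *\<^sub>v (u @\<^sub>v w)) $ (i * N + k)
      = (M_bar n N *\<^sub>v u) $ (i * N + k) - (B1_bar n A \<kappa> N *\<^sub>v w) $ (i * N + k)"
    unfolding E_mat_mult_vec using block_carriers block_index[OF ik] by (simp del: index_mult_mat_vec)
  then show ?thesis
    unfolding M B1_bar_mult_vec[OF ik] using ik by (auto simp: q_node_def field_simps)
qed

lemma E_mat_mult_vec_p:
  assumes ik: "i < n" "k < N"
  shows "(E_mat n A \<kappa> N *\<^sub>v (u @\<^sub>v w)) $ (n * N + (i * N + k))
    = (p_node N w i k + p_node N w i (k + 1)) / 2"
proof -
  have "(transpose_mat (M_bar n N) *\<^sub>v w) $ (i * N + k)
      = (\<Sum>j<n. 1\<^sub>m n $$ (i, j) * (\<Sum>l<N. transpose_mat (M_mat N) $$ (k, l) * w $ (j * N + l)))"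
    unfolding M_bar_def transpose_kron transpose_one
    by (rule kron_mult_vec'[OF one_carrier_mat _ w ik]) (use M_mat_carrier in auto)
  also have "\<dots> = (\<Sum>j<n. 1\<^sub>m n $$ (i, j) * ((w $ (j * N + k) + (case k of 0 \<Rightarrow> 0 | Suc l \<Rightarrow> w $ (j * N + l))) / 2))"
  proof (intro sum.cong refl arg_cong2[of _ _ _ _ "(*)"])
    fix j
    show "(\<Sum>l<N. transpose_mat (M_mat N) $$ (k, l) * w $ (j * N + l))
        = (w $ (j * N + k) + (case k of 0 \<Rightarrow> 0 | Suc l \<Rightarrow> w $ (j * N + l))) / 2"
      using sum_M_mat_transpose[OF ik(2), of "\<lambda>l. w $ (j * N + l)"] ik M_mat_carrier[of N] by simp
  qed
  also have "\<dots> = (w $ (i * N + k) + (case k of 0 \<Rightarrow> 0 | Suc l \<Rightarrow> w $ (i * N + l))) / 2"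
    by (rule sum_one_mat[OF ik(1)])
  finally have M: "(transpose_mat (M_bar n N) *\<^sub>v w) $ (i * N + k) = \<dots>" .
  have "(E_mat n A \<kappa> N *\<^sub>v (u @\<^sub>v w)) $ (n * N + (i * N + k)) = (transpose_mat (M_bar n N) *\<^sub>v w) $ (i * N + k)"
    unfolding E_mat_mult_vec using block_carriers block_index[OF ik] by (simp del: index_mult_mat_vec)
  then show ?thesis unfolding M by (simp add: p_node_def)
qed

lemma J_mat_mult_vec:
  "J_mat n A \<kappa> N *\<^sub>v (u @\<^sub>v w)
     = (kron A (D_mat N) *\<^sub>v w)
       @\<^sub>v (- (kron (transpose_mat A) (transpose_mat (D_mat N)) *\<^sub>v u) - B2_bar n \<kappa> N *\<^sub>v w)"
proof -
  have AD: "A_bar A N * D_bar n N = kron A (D_mat N)"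
    unfolding A_bar_def D_bar_def
    using A D_mat_carrier[of N] by (simp add: kron_mult[of _ n n _ N N _ n _ N])
  have ADt: "transpose_mat (A_bar A N) * transpose_mat (D_bar n N) = kron (transpose_mat A) (transpose_mat (D_mat N))"
    unfolding A_bar_def D_bar_def transpose_kron
    using A D_mat_carrier[of N] by (simp add: kron_mult[of _ n n _ N N _ n _ N])
  let ?X = "kron (transpose_mat A) (transpose_mat (D_mat N))"
  have c: "kron A (D_mat N) \<in> carrier_mat (n * N) (n * N)" "?X \<in> carrier_mat (n * N) (n * N)"
    using A D_mat_carrier[of N] by (auto intro!: kron_carrier)
  have "(- ?X) *\<^sub>v u = - (?X *\<^sub>v u)" "(- B2_bar n \<kappa> N) *\<^sub>v w = - (B2_bar n \<kappa> N *\<^sub>v w)"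
    using block_carriers c u w by (auto intro!: uminus_mult_mat_vec)
  then show ?thesis
    unfolding J_mat_def AD ADt using block_carriers c u w
    by (subst four_block_mat_mult_vec[of _ "n * N" "n * N" _ "n * N" _ "n * N"]) (auto intro!: eq_vecI)
qed

lemma J_mat_mult_vec_q:
  assumes ik: "i < n" "k < N"
  shows "(J_mat n A \<kappa> N *\<^sub>v (u @\<^sub>v w)) $ (i * N + k)
    = (\<Sum>j<n. A $$ (i, j) * (p_node N w j (k + 1) - p_node N w j k))"
proof -
  have "(J_mat n A \<kappa> N *\<^sub>v (u @\<^sub>v w)) $ (i * N + k) = (kron A (D_mat N) *\<^sub>v w) $ (i * N + k)"
    unfolding J_mat_mult_vec using A D_mat_carrier[of N] block_carriers block_index[OF ik]
    by (simp del: index_mult_mat_vec)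
  then show ?thesis
    unfolding kron_mult_vec'[OF A D_mat_carrier w ik] sum_D_mat[OF ik(2)] by (simp add: p_node_def)
qed

text \<open>In the last element the difference lacks the boundary value -A^-T K e^p. Multiplied by
  A^T it becomes -K e^p, which is what \<open>B2_bar\<close> contributes.\<close>

lemma J_mat_mult_vec_p:
  assumes ik: "i < n" "k < N"
  shows "(J_mat n A \<kappa> N *\<^sub>v (u @\<^sub>v w)) $ (n * N + (i * N + k))
    = (\<Sum>j<n. A $$ (j, i) * (q_node n A \<kappa> N u w j (k + 1) - q_node n A \<kappa> N u w j k))"
proof -
  note G = minv_invertible[OF A inv]
  let ?X = "kron (transpose_mat A) (transpose_mat (D_mat N))"
  have J: "(J_mat n A \<kappa> N *\<^sub>v (u @\<^sub>v w)) $ (n * N + (i * N + k))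
      = - (?X *\<^sub>v u) $ (i * N + k) - (B2_bar n \<kappa> N *\<^sub>v w) $ (i * N + k)"
    unfolding J_mat_mult_vec using A D_mat_carrier[of N] block_carriers block_index[OF ik]
    by (simp del: index_mult_mat_vec)
  have "(?X *\<^sub>v u) $ (i * N + k)
      = (\<Sum>j<n. transpose_mat A $$ (i, j) * (\<Sum>l<N. transpose_mat (D_mat N) $$ (k, l) * u $ (j * N + l)))"
    by (rule kron_mult_vec'[OF _ _ u ik]) (use A D_mat_carrier in auto)
  also have "\<dots> = (\<Sum>j<n. A $$ (j, i) * (u $ (j * N + k) - (if Suc k = N then 0 else u $ (j * N + Suc k))))"
  proof (intro sum.cong refl)
    fix j assume "j \<in> {..<n}"
    then show "transpose_mat A $$ (i, j) * (\<Sum>l<N. transpose_mat (D_mat N) $$ (k, l) * u $ (j * N + l))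
        = A $$ (j, i) * (u $ (j * N + k) - (if Suc k = N then 0 else u $ (j * N + Suc k)))"
      using sum_D_mat_transpose[OF ik(2), of "\<lambda>l. u $ (j * N + l)"] ik A D_mat_carrier[of N] by simp
  qed
  finally have X: "(?X *\<^sub>v u) $ (i * N + k) = \<dots>" .
  have "(B2_bar n \<kappa> N *\<^sub>v w) $ (i * N + k) = (\<Sum>j<n. K_mat n \<kappa> $$ (i, j) * (if Suc k = N then w $ (j * N + k) else 0))"
    unfolding B2_bar_def kron_mult_vec'[OF K_mat_carrier B2_carrier w ik] sum_tr_mat[OF ik(2)] ..
  also have "\<dots> = (if Suc k = N then \<kappa> i * p_node N w i N else 0)"
    using ik by (auto simp: K_mat_def mat_diag_def p_node_def if_distrib[of "\<lambda>x. x * _"] sum.delta cong: if_cong)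
  finally have B2: "(B2_bar n \<kappa> N *\<^sub>v w) $ (i * N + k) = \<dots>" .
  show ?thesis
  proof (cases "Suc k = N")
    case False
    then show ?thesis
      unfolding J X B2 using ik by (auto simp: q_node_def sum_negf[symmetric] algebra_simps intro!: sum.cong)
  next
    case True
    have GA: "(\<Sum>j<n. minv A $$ (l, j) * A $$ (j, i)) = (if l = i then 1 else 0)" if "l < n" for l
      using arg_cong[OF G(3), of "\<lambda>X. X $$ (l, i)"] that ik(1) A G(1)
      by (simp add: scalar_prod_def atLeast0LessThan)
    have "(\<Sum>j<n. A $$ (j, i) * (\<Sum>l<n. minv A $$ (l, j) * (\<kappa> l * p_node N w l N)))
        = (\<Sum>l<n. (\<Sum>j<n. minv A $$ (l, j) * A $$ (j, i)) * (\<kappa> l * p_node N w l N))"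
      unfolding sum_distrib_left sum_distrib_right by (subst sum.swap) (simp add: mult_ac)
    also have "\<dots> = \<kappa> i * p_node N w i N"
      using ik by (simp add: GA if_distrib[of "\<lambda>x. x * _"] sum.delta cong: if_cong)
    finally have "(\<Sum>j<n. A $$ (j, i) * q_node n A \<kappa> N u w j (k + 1)) = - (\<kappa> i * p_node N w i N)"
      using True by (simp add: q_node_def sum_negf)
    then show ?thesis
      unfolding J X B2 using ik True by (simp add: right_diff_distrib sum_subtractf) (simp add: q_node_def)
  qed
qed

end

end

section \<open>Parameters, system matrix and energy in terms of element values\<close>

lemma Theta_bar_eq:
  "Theta_bar xl xr n N \<theta> = mat_diag (n * N) (\<lambda>r. \<theta> (r div N) (node xl xr N (r mod N + 1)))"
proof -
  have "Theta_bar xl xr n N \<theta>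
      = mat_diag (n * N) (\<lambda>r. \<theta> ([0..<n] ! (r div N)) (node xl xr N (r mod N + 1)))"
    unfolding Theta_bar_def Theta_disc_def
    using diag_block_mat_diag[of N "\<lambda>i r. \<theta> i (node xl xr N (r + 1))" "[0..<n]"] by simp
  also have "\<dots> = mat_diag (n * N) (\<lambda>r. \<theta> (r div N) (node xl xr N (r mod N + 1)))"
    by (auto simp: mat_diag_def less_mult_imp_div_less intro!: eq_matI)
  finally show ?thesis .
qed

context
  fixes xl xr :: real and n N :: nat and A :: "real mat" and \<kappa> :: "nat \<Rightarrow> real"
    and \<theta>q \<theta>p :: "nat \<Rightarrow> real \<Rightarrow> real"
  assumes A: "A \<in> carrier_mat n n" and inv: "invertible_mat A"
    and \<theta>: "\<forall>\<theta>\<in>{\<theta>q, \<theta>p}. \<forall>i<n. \<forall>k<N. 0 < \<theta> i (node xl xr N (k + 1))"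
begin

lemma Sd_mat_mult_vec:
  fixes x :: "real vec"
  assumes x: "x \<in> carrier_vec (n * N + n * N)" and ik: "i < n" "k < N"
  shows "(Sd_mat xl xr n A \<kappa> \<theta>q \<theta>p N *\<^sub>v x) $ (i * N + k)
      = (E_mat n A \<kappa> N *\<^sub>v x) $ (i * N + k) / \<theta>q i (node xl xr N (k + 1))"
    and "(Sd_mat xl xr n A \<kappa> \<theta>q \<theta>p N *\<^sub>v x) $ (n * N + (i * N + k))
      = (E_mat n A \<kappa> N *\<^sub>v x) $ (n * N + (i * N + k)) / \<theta>p i (node xl xr N (k + 1))"
proof -
  note E = E_mat_carrier[OF A inv, of \<kappa> N]
  have minv: "minv (Theta_bar xl xr n N \<theta>) = mat_diag (n * N) (\<lambda>r. 1 / \<theta> (r div N) (node xl xr N (r mod N + 1)))"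
    if "\<theta> \<in> {\<theta>q, \<theta>p}" for \<theta>
    unfolding Theta_bar_eq
  proof (rule minv_mat_diag)
    fix r assume r: "r < n * N"
    then have "N > 0" by (auto intro: gr0I)
    with r \<theta>[rule_format, OF that, of "r div N" "r mod N"] show "\<theta> (r div N) (node xl xr N (r mod N + 1)) \<noteq> 0"
      by (simp add: less_mult_imp_div_less)
  qed
  define d where "d r = (if r < n * N then 1 / \<theta>q (r div N) (node xl xr N (r mod N + 1))
    else 1 / \<theta>p ((r - n * N) div N) (node xl xr N ((r - n * N) mod N + 1)))" for r
  have "Sd_mat xl xr n A \<kappa> \<theta>q \<theta>p N = mat_diag (n * N + n * N) d * E_mat n A \<kappa> N"
    unfolding Sd_mat_def d_def
    by (simp only: minv[OF insertI1] minv[OF insertI2[OF singletonI]] four_block_mat_diag)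
  then have "Sd_mat xl xr n A \<kappa> \<theta>q \<theta>p N *\<^sub>v x = mat_diag (n * N + n * N) d *\<^sub>v (E_mat n A \<kappa> N *\<^sub>v x)"
    by (simp only: assoc_mult_mat_vec[OF mat_diag_dim E x])
  also have "\<dots> = vec (n * N + n * N) (\<lambda>r. d r * (E_mat n A \<kappa> N *\<^sub>v x) $ r)"
    using E x by (intro mat_diag_mult_vec) auto
  finally have Sd: "Sd_mat xl xr n A \<kappa> \<theta>q \<theta>p N *\<^sub>v x = \<dots>" .
  show "(Sd_mat xl xr n A \<kappa> \<theta>q \<theta>p N *\<^sub>v x) $ (i * N + k)
      = (E_mat n A \<kappa> N *\<^sub>v x) $ (i * N + k) / \<theta>q i (node xl xr N (k + 1))"
    "(Sd_mat xl xr n A \<kappa> \<theta>q \<theta>p N *\<^sub>v x) $ (n * N + (i * N + k))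
      = (E_mat n A \<kappa> N *\<^sub>v x) $ (n * N + (i * N + k)) / \<theta>p i (node xl xr N (k + 1))"
    unfolding Sd using ik block_index[OF ik] by (simp_all add: d_def del: index_mult_mat_vec)
qed

text \<open>Both factors of the inner product contain \<open>E_mat\<close>, and the rest is
  diagonal, so the energy is a weighted sum of squares of element averages.\<close>

lemma disc_energy_eq:
  assumes u: "u \<in> carrier_vec (n * N)" and w: "w \<in> carrier_vec (n * N)"
  shows "disc_energy xl xr n A \<kappa> \<theta>q \<theta>p N u w
    = step xl xr N / 2 * (\<Sum>i<n. \<Sum>k<N.
        ((E_mat n A \<kappa> N *\<^sub>v (u @\<^sub>v w)) $ (i * N + k))\<^sup>2 / \<theta>q i (node xl xr N (k + 1))
      + ((E_mat n A \<kappa> N *\<^sub>v (u @\<^sub>v w)) $ (n * N + (i * N + k)))\<^sup>2 / \<theta>p i (node xl xr N (k + 1)))"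
proof -
  let ?x = "u @\<^sub>v w" and ?h = "step xl xr N"
  let ?Sd = "Sd_mat xl xr n A \<kappa> \<theta>q \<theta>p N *\<^sub>v ?x" and ?E = "E_mat n A \<kappa> N *\<^sub>v ?x"
  note E = E_mat_carrier[OF A inv, of \<kappa> N]
  have x: "?x \<in> carrier_vec (n * N + n * N)" using u w by auto
  have "Qd_mat xl xr n A \<kappa> N *\<^sub>v ?x = ?h \<cdot>\<^sub>v ?E"
    unfolding Qd_mat_def by (rule smult_mat_mult_vec[OF E x])
  then have "disc_energy xl xr n A \<kappa> \<theta>q \<theta>p N u w = 1 / 2 * (\<Sum>r<n * N + n * N. ?Sd $ r * (?h * ?E $ r))"
    unfolding disc_energy_def using E by (simp add: scalar_prod_def atLeast0LessThan del: index_mult_mat_vec)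
  also have "\<dots> = ?h / 2 * (\<Sum>r<n * N + n * N. ?Sd $ r * ?E $ r)"
    by (simp add: sum_distrib_left mult_ac del: index_mult_mat_vec)
  also have "(\<Sum>r<n * N + n * N. ?Sd $ r * ?E $ r)
      = (\<Sum>i<n. \<Sum>k<N. (?E $ (i * N + k))\<^sup>2 / \<theta>q i (node xl xr N (k + 1))
          + (?E $ (n * N + (i * N + k)))\<^sup>2 / \<theta>p i (node xl xr N (k + 1)))"
    unfolding sum_lessThan_add sum_blocks sum.distrib
    by (intro arg_cong2[of _ _ _ _ "(+)"] sum.cong refl)
      (simp_all add: Sd_mat_mult_vec[OF x] power2_eq_square del: index_mult_mat_vec)
  finally show ?thesis .
qed

end

lemma has_real_derivative_mult_mat_vec:
  assumes B: "B \<in> carrier_mat M M'" and r: "r < M"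
    and f: "\<And>s. s \<in> S \<Longrightarrow> f s \<in> carrier_vec M'" and t: "t \<in> S"
    and d: "d \<in> carrier_vec M'" "\<And>c. c < M' \<Longrightarrow> ((\<lambda>s. f s $ c) has_real_derivative d $ c) (at t within S)"
  shows "((\<lambda>s. (B *\<^sub>v f s) $ r) has_real_derivative (B *\<^sub>v d) $ r) (at t within S)"
\<comment> \<open>The dimension of \<open>f s\<close> is known only for s in \<open>S\<close>, so
  the product agrees with the explicit sum only there.\<close>
proof (rule has_field_derivative_transform_within[where d = 1])
  show "((\<lambda>s. \<Sum>c<M'. B $$ (r, c) * f s $ c) has_real_derivative (B *\<^sub>v d) $ r) (at t within S)"
    using B r d(1) by (auto simp: scalar_prod_def atLeast0LessThan intro!: DERIV_sum DERIV_cmult d(2))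
  show "(\<Sum>c<M'. B $$ (r, c) * f s $ c) = (B *\<^sub>v f s) $ r" if "s \<in> S" for s
    using B r f[OF that] by (simp add: scalar_prod_def atLeast0LessThan)
qed (use t in auto)

lemma node_mem:
  assumes "xl < xr" "k \<le> N" "0 < N"
  shows "node xl xr N k \<in> {xl..xr}"
proof -
  have "real k * (xr - xl) \<le> real N * (xr - xl)" "0 \<le> real k * (xr - xl)"
    using assms by (auto intro: mult_right_mono)
  then show ?thesis using assms by (simp add: node_def step_def field_simps)
qed

section \<open>Transfer of the decay from the scalar system to the matrices\<close>

theorem theorem2:
  fixes xl xr \<delta> :: real and n :: nat and A :: "real mat" and \<kappa> :: "nat \<Rightarrow> real"
    and \<theta>q \<theta>p :: "nat \<Rightarrow> real \<Rightarrow> real"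
  assumes "xl < xr" and "n \<ge> 1"
    and "A \<in> carrier_mat n n" and "invertible_mat A"
    and "\<And>i. i < n \<Longrightarrow> 0 < \<kappa> i"
    and "\<And>\<theta> i x. \<theta> \<in> {\<theta>q, \<theta>p} \<Longrightarrow> i < n \<Longrightarrow> x \<in> {xl..xr} \<Longrightarrow> 0 < \<theta> i x"
    and "\<And>\<theta> i. \<theta> \<in> {\<theta>q, \<theta>p} \<Longrightarrow> i < n \<Longrightarrow> C1_on {xl..xr} (\<theta> i)"
    and "0 < \<delta>"
    and "\<And>N \<theta> i. N \<ge> 1 \<Longrightarrow> \<theta> \<in> {\<theta>q, \<theta>p} \<Longrightarrow> i < n \<Longrightarrow>
           psd (Theta_disc xl xr N (\<theta> i) - O_disc xl xr N (\<theta> i) - \<delta> \<cdot>\<^sub>m Theta_disc xl xr N (\<theta> i))"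
  shows "\<forall>\<epsilon>. 0 < \<epsilon> \<and> \<epsilon> \<le> min (eps0 xl xr n A \<theta>q \<theta>p) (eps1 xl xr n A \<kappa> \<theta>q \<theta>p) \<longrightarrow>
    (let \<alpha> = \<delta> * \<epsilon> * eps0 xl xr n A \<theta>q \<theta>p / (\<epsilon> + eps0 xl xr n A \<theta>q \<theta>p) in
      \<forall>N\<ge>1. \<exists>c0\<ge>1. \<forall>vq vp. approx_solution xl xr n A \<kappa> \<theta>q \<theta>p N vq vp \<longrightarrow>
        (\<forall>t\<ge>0. disc_energy xl xr n A \<kappa> \<theta>q \<theta>p N (vq t) (vp t)
          \<le> c0 * exp (- \<alpha> * t) * disc_energy xl xr n A \<kappa> \<theta>q \<theta>p N (vq 0) (vp 0)))"
proof (unfold Let_def, intro allI impI)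
  fix \<epsilon> :: real and N :: nat
  assume \<epsilon>: "0 < \<epsilon> \<and> \<epsilon> \<le> min (eps0 xl xr n A \<theta>q \<theta>p) (eps1 xl xr n A \<kappa> \<theta>q \<theta>p)" and N: "1 \<le> N"
  define \<eta> where "\<eta> = eta_Theta xl xr n \<theta>q \<theta>p"
  define \<mu> where "\<mu> = mu_P1 n A"
  define \<nu> where "\<nu> = mu_Psi xr n A \<kappa> \<theta>q \<theta>p"
  define h where "h = step xl xr N"
  note A = assms(3,4)
  note G = minv_invertible[OF A]
  obtain m where m: "N = Suc m" using N by (cases N) auto
  have h: "h > 0" unfolding h_def step_def using assms(1) N by simp
  have len: "h * real (m + 1) = xr - xl" unfolding h_def step_def m by simp
  have node: "node xl xr N (k + 1) \<in> {xl..xr}" if "k \<le> m" for k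
    using assms(1) that m by (intro node_mem) auto
  have node_right: "node xl xr N (m + 1) = xr"
    using len unfolding node_def h_def by (simp add: mult.commute)
  have eta_nonneg: "0 \<le> \<eta>"
    unfolding \<eta>_def by (rule eta_Theta_le(1)[OF assms(2,1)]) (rule assms(6))
  have eta: "\<eta> \<le> \<theta> i x" if "\<theta> \<in> {\<theta>q, \<theta>p}" "i < n" "x \<in> {xl..xr}" for \<theta> i x
    unfolding \<eta>_def by (rule eta_Theta_le(2)[OF assms(2,1) _ that]) (rule assms(6))
  have eps0: "eps0 xl xr n A \<theta>q \<theta>p = \<eta> / (h * real (m + 1) * \<mu>)"
    unfolding eps0_def len \<eta>_def \<mu>_def ..
  \<comment> \<open>Division by zero yields 0, so a positive quotient with nonnegative numerator
    forces both \<eta> and \<mu> to be positive. The same device gives \<nu> its sign below.\<close>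
  then have "\<eta> / (h * real (m + 1) * \<mu>) > 0" using \<epsilon> by simp
  then have pos: "\<eta> > 0" "\<mu> > 0"
    using eta_nonneg assms(1) unfolding len by (auto simp: zero_less_divide_iff zero_less_mult_iff)
  have eps1: "\<epsilon> * (h * real (m + 1) * \<nu>) \<le> 2 * eta_K n \<kappa>"
  proof -
    have *: "0 < \<epsilon>" "\<epsilon> \<le> 2 * eta_K n \<kappa> / ((xr - xl) * \<nu>)"
      using \<epsilon> unfolding eps1_def \<nu>_def by auto
    then have "0 < 2 * eta_K n \<kappa> / ((xr - xl) * \<nu>)" by linarith
    then have "(xr - xl) * \<nu> > 0"
      using eta_K_le(1)[of n \<kappa>, OF assms(2,5)] by (auto simp: zero_less_divide_iff)
    with * show ?thesis unfolding len by (simp add: pos_le_divide_eq)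
  qed
  interpret semidiscrete_system n m "\<lambda>i j. A $$ (i, j)" "\<lambda>i j. minv A $$ (i, j)" \<kappa>
    "\<lambda>i k. \<theta>q i (node xl xr N (k + 1))" "\<lambda>i k. \<theta>p i (node xl xr N (k + 1))" h \<delta> \<mu> \<nu> \<eta> "eta_K n \<kappa>"
  proof (unfold_locales, goal_cases)
    case (3 j l)
    then show ?case using arg_cong[OF G(3), of "\<lambda>X. X $$ (j, l)"] A(1) G(1)
      by (simp add: scalar_prod_def atLeast0LessThan)
  next
    case (4 i l)
    then show ?case using arg_cong[OF G(2), of "\<lambda>X. X $$ (l, i)"] A(1) G(1)
      by (simp add: scalar_prod_def atLeast0LessThan mult.commute)
  next
    case (10 x y)
    show ?case unfolding \<mu>_def by (rule mu_P1_bound[OF A])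
  next
    case (11 y)
    have "\<theta>q i xr \<noteq> 0" "\<theta>p i xr \<noteq> 0" if "i < n" for i
      using assms(6)[of \<theta>q i xr] assms(6)[of \<theta>p i xr] assms(1) that by auto
    then show ?case unfolding \<nu>_def node_right by (intro mu_Psi_bound[OF A])
  next
    case (12 \<theta> i p)
    have psd: "psd (Theta_disc xl xr (Suc m) (\<theta>' i) - O_disc xl xr (Suc m) (\<theta>' i)
        - \<delta> \<cdot>\<^sub>m Theta_disc xl xr (Suc m) (\<theta>' i))" if "\<theta>' \<in> {\<theta>q, \<theta>p}" for \<theta>'
      using assms(9)[OF N that 12(2)] unfolding m .
    show ?case
      using 12(1) psd_coercive[OF psd[of \<theta>q], of p] psd_coercive[OF psd[of \<theta>p], of p] unfolding m by auto
  qed (use h assms(8) pos eta eta_K_le(2)[of n \<kappa>, OF assms(2,5)] node in auto)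
  define r where "r = \<epsilon> * (h * (real m + 1 / 2) * \<mu> / \<eta>)"
  show "\<exists>c0\<ge>1. \<forall>vq vp. approx_solution xl xr n A \<kappa> \<theta>q \<theta>p N vq vp \<longrightarrow>
        (\<forall>t\<ge>0. disc_energy xl xr n A \<kappa> \<theta>q \<theta>p N (vq t) (vp t)
          \<le> c0 * exp (- (\<delta> * \<epsilon> * eps0 xl xr n A \<theta>q \<theta>p / (\<epsilon> + eps0 xl xr n A \<theta>q \<theta>p)) * t)
            * disc_energy xl xr n A \<kappa> \<theta>q \<theta>p N (vq 0) (vp 0))"
  \<comment> \<open>The witness is the ratio of the constants in the equivalence of \<open>F\<close>
    and the energy. It depends on N through r but not on the solution.\<close>
  proof (intro exI[of _ "(1 + r) / (1 - r)"] conjI allI impI)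
    have r: "0 < r" "r < 1"
      unfolding r_def using coupling_less \<epsilon> unfolding eps0 by auto
    then show "1 \<le> (1 + r) / (1 - r)" by simp
    fix vq vp and t :: real
    assume sol: "approx_solution xl xr n A \<kappa> \<theta>q \<theta>p N vq vp" and t: "t \<ge> 0"
    define x where "x s = vq s @\<^sub>v vp s" for s
    define E where "E = E_mat n A \<kappa> N"
    define q where "q s i k = (E *\<^sub>v x s) $ (i * N + k) / \<theta>q i (node xl xr N (k + 1))" for s i k
    define p where "p s i k = (E *\<^sub>v x s) $ (n * N + (i * N + k)) / \<theta>p i (node xl xr N (k + 1))" for s i k
    let ?a = "\<lambda>s. p_node N (vp s)" and ?b = "\<lambda>s. q_node n A \<kappa> N (vq s) (vp s)"
    have v: "vq s \<in> carrier_vec (n * N)" "vp s \<in> carrier_vec (n * N)" if "s \<ge> 0" for s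
      using sol that unfolding approx_solution_def by auto
    have dims: "dim_vec (vq s) = n * N" "dim_vec (vp s) = n * N" if "s \<ge> 0" for s
      using v[OF that] by auto
    have \<theta>: "\<forall>\<theta>\<in>{\<theta>q, \<theta>p}. \<forall>i<n. \<forall>k<N. 0 < \<theta> i (node xl xr N (k + 1))"
      using assms(6)[OF _ _ node] m by auto
    have E: "E \<in> carrier_mat (n * N + n * N) (n * N + n * N)"
      unfolding E_def by (rule E_mat_carrier[OF A])
    have energy: "disc_energy xl xr n A \<kappa> \<theta>q \<theta>p N (vq s) (vp s) = energy (q s) (p s)" if s: "s \<ge> 0" for s
    proof -
      have 1: "\<theta>q i (node xl xr N (k + 1)) * (q s i k)\<^sup>2 + \<theta>p i (node xl xr N (k + 1)) * (p s i k)\<^sup>2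
        = ((E *\<^sub>v x s) $ (i * N + k))\<^sup>2 / \<theta>q i (node xl xr N (k + 1))
          + ((E *\<^sub>v x s) $ (n * N + (i * N + k)))\<^sup>2 / \<theta>p i (node xl xr N (k + 1))"
        if "i < n" "k < N" for i k
        using \<theta>[rule_format, of \<theta>q i k] \<theta>[rule_format, of \<theta>p i k] that unfolding q_def p_def
        by (simp add: power2_eq_square del: index_mult_mat_vec)
      have 2: "{..m} = {..<N}" using m by auto
      show ?thesis
        unfolding energy_def
        unfolding disc_energy_eq[OF A \<theta> v[OF s]] h_def[symmetric] E_def[symmetric] x_def[symmetric] 2
        by (intro arg_cong2[of _ _ _ _ "(*)"] refl sum.cong 1[symmetric]) auto
    qed
    have deriv: "((\<lambda>s. q s i k) has_real_derivative 1 / h * (\<Sum>j<n. A $$ (i, j) * (?a t j (k + 1) - ?a t j k))) (at t within {0..})"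
      "((\<lambda>s. p s i k) has_real_derivative 1 / h * (\<Sum>j<n. A $$ (j, i) * (?b t j (k + 1) - ?b t j k))) (at t within {0..})"
      if t: "t \<ge> 0" and ik: "i < n" "k \<le> m" for t i k
    proof -
      obtain dq dp where d: "dq \<in> carrier_vec (n * N)" "dp \<in> carrier_vec (n * N)"
        "has_vec_derivative_within vq dq t {0..}" "has_vec_derivative_within vp dp t {0..}"
        and ode: "Sd_mat xl xr n A \<kappa> \<theta>q \<theta>p N *\<^sub>v (dq @\<^sub>v dp) = (1 / h) \<cdot>\<^sub>v (J_mat n A \<kappa> N *\<^sub>v (vq t @\<^sub>v vp t))"
        using sol t unfolding approx_solution_def h_def by blast
      have k: "k < N" using ik m by simp
      have dx: "((\<lambda>s. x s $ c) has_real_derivative (dq @\<^sub>v dp) $ c) (at t within {0..})"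
        if c: "c < n * N + n * N" for c
      proof (cases "c < n * N")
        case True
        show ?thesis
          by (rule has_field_derivative_transform_within[of "\<lambda>s. vq s $ c" _ _ _ 1])
            (use d(1,3) True t dims in \<open>auto simp: has_vec_derivative_within_def x_def\<close>)
      next
        case False
        then have "c - n * N < n * N" using c by simp
        show ?thesis
          by (rule has_field_derivative_transform_within[of "\<lambda>s. vp s $ (c - n * N)" _ _ _ 1])
            (use d c False t dims in \<open>auto simp: has_vec_derivative_within_def x_def\<close>)
      qed
      have E': "((\<lambda>s. (E *\<^sub>v x s) $ r) has_real_derivative (E *\<^sub>v (dq @\<^sub>v dp)) $ r) (at t within {0..})"
        if "r < n * N + n * N" for r
        by (rule has_real_derivative_mult_mat_vec[OF E that]) (use t d v dx in \<open>auto simp: x_def\<close>)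
      have dc: "dq @\<^sub>v dp \<in> carrier_vec (n * N + n * N)" using d by auto
      note J = J_mat_carrier[OF A, of \<kappa> N]
      note Sd = Sd_mat_mult_vec[OF A \<theta> dc ik(1) k]
      have rows: "i * N + k < n * N + n * N" "n * N + (i * N + k) < n * N + n * N"
        using block_index[OF ik(1) k] by auto
      \<comment> \<open>The equation is not solved for the derivatives of the nodal values: its left
        side already is the time derivative of the element quantities \<open>q\<close> and
        \<open>p\<close>.\<close>
      have q': "(E *\<^sub>v (dq @\<^sub>v dp)) $ (i * N + k) / \<theta>q i (node xl xr N (k + 1))
          = 1 / h * (\<Sum>j<n. A $$ (i, j) * (?a t j (k + 1) - ?a t j k))"
        unfolding E_def Sd(1)[symmetric] ode
        using J block_index[OF ik(1) k] J_mat_mult_vec_q[OF A v[OF t] ik(1) k]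
        by (simp del: index_mult_mat_vec)
      show "((\<lambda>s. q s i k) has_real_derivative 1 / h * (\<Sum>j<n. A $$ (i, j) * (?a t j (k + 1) - ?a t j k))) (at t within {0..})"
        unfolding q_def q'[symmetric] by (rule DERIV_cdivide[OF E'[OF rows(1)]])
      have p': "(E *\<^sub>v (dq @\<^sub>v dp)) $ (n * N + (i * N + k)) / \<theta>p i (node xl xr N (k + 1))
          = 1 / h * (\<Sum>j<n. A $$ (j, i) * (?b t j (k + 1) - ?b t j k))"
        unfolding E_def Sd(2)[symmetric] ode
        using J block_index[OF ik(1) k] J_mat_mult_vec_p[OF A v[OF t] ik(1) k]
        by (simp del: index_mult_mat_vec)
      show "((\<lambda>s. p s i k) has_real_derivative 1 / h * (\<Sum>j<n. A $$ (j, i) * (?b t j (k + 1) - ?b t j k))) (at t within {0..})"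
        unfolding p_def p'[symmetric] by (rule DERIV_cdivide[OF E'[OF rows(2)]])
    qed
    show "disc_energy xl xr n A \<kappa> \<theta>q \<theta>p N (vq t) (vp t)
        \<le> (1 + r) / (1 - r) * exp (- (\<delta> * \<epsilon> * eps0 xl xr n A \<theta>q \<theta>p / (\<epsilon> + eps0 xl xr n A \<theta>q \<theta>p)) * t)
            * disc_energy xl xr n A \<kappa> \<theta>q \<theta>p N (vq 0) (vp 0)"
      unfolding energy[OF t] energy[OF order_refl] eps0 r_def
    proof (rule energy_decay[of \<epsilon> ?a ?b])
      show "\<epsilon> \<le> \<eta> / (h * real (m + 1) * \<mu>)" using \<epsilon> unfolding eps0 by simp
      show "?a s i 0 = 0" for s i by (simp add: p_node_def)
      show "?b s i (m + 1) = - (\<Sum>l<n. minv A $$ (l, i) * (\<kappa> l * ?a s l (m + 1)))" for s i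
        by (simp add: q_node_def m)
      show "q s i k = (?b s i k + ?b s i (k + 1)) / 2 / \<theta>q i (node xl xr N (k + 1))"
        if "0 \<le> s" "i < n" "k \<le> m" for s i k
      proof -
        have "k < N" using that m by simp
        from E_mat_mult_vec_q[OF A v[OF that(1)] that(2) this] show ?thesis
          unfolding q_def E_def x_def by (simp only:)
      qed
      show "p s i k = (?a s i k + ?a s i (k + 1)) / 2 / \<theta>p i (node xl xr N (k + 1))"
        if "0 \<le> s" "i < n" "k \<le> m" for s i k
      proof -
        have "k < N" using that m by simp
        from E_mat_mult_vec_p[OF A v[OF that(1)] that(2) this] show ?thesis
          unfolding p_def E_def x_def by (simp only:)
      qed
    qed (use \<epsilon> eps1 deriv t in auto)
  qed
qed

end
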